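(* Let $(G,\Gamma)$ be a periodic graph with vertex degree bounded by $D$. Assume further that the group $\Gamma$ is sofic and that $F$ is a fundamental domain of finite co-volume $\mathfrak v:=\sum_{f\in F}1/|\Gamma_f|$. Then there is a weakly convergent sequence of finite graphs $(G_n)$ such that $$\lim_{n\to\infty}Z_{G_n,{\rm norm}}^{\,\mathfrak v}=Z_{(G,\Gamma)}$$ uniformly on compact subsets of $B_{(D-1)^{-1}}=\{u\in\mathbb C:|u|<(D-1)^{-1}\}$.
   Context: Graphs are undirected without loops or multiple edges and have uniformly bounded vertex degree. $B_r^G(x)$ is the induced graph on the ball of radius $r$ about $x$, rooted at $x$. The radius $\rho$ of a finite connected rooted graph is the maximal distance of a vertex from the root. $\mathcal A^D$ is the set of isomorphism classes of finite connected rooted graphs with vertex degrees at most $D$. Periodic graph: a pair $(G,\Gamma)$ with $G=(V,E)$ a countably infinite connected graph and $\Gamma$ a countable subgroup of the automorphism group of $G$ such that (i) each stabilizer $\Gamma_x=\{\gamma\in\Gamma:\gamma x=x\}$, $x\in V$, is finite, and (ii) there is a set $F\subset V$ containing exactly one representative of each $\Gamma$-orbit in $V$ with $\sum_{f\in F}\frac1{|\Gamma_f|}<\infty$. Such $F$ (possibly infinite) is called a fundamental domain (of finite co-volume). Sofic group: a group $\Gamma$ with unit $e$ is sofic if for every finite $T\subseteq\Gamma$ and every $\varepsilon>0$ there are $n\in\mathbb N$ and a map $\sigma:T\to\mathrm{Sym}(n)$, $s\mapsto\sigma_s$, such that $d_H(\sigma_s\sigma_t,\sigma_{st})<\varepsilon$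 whenever $s,t,st\in T$; $d_H(\sigma_e,\mathrm{Id}_n)<\varepsilon$ if $e\in T$; and $d_H(\sigma_s,\sigma_t)\ge1-\varepsilon$ for $s\ne t$ in $T$; here $d_H(\sigma,\tau)=\frac1n\#\{a\in\{1,\dots,n\}:\sigma(a)\ne\tau(a)\}$. For a finite graph $H=(V_H,E_H)$, $p(H,\alpha)=|\{x\in V_H:B^H_{\rho(\alpha)}(x)\in\alpha\}|/|V_H|$. A sequence $(G_n)$ of finite graphs with vertex degrees uniformly bounded by $D$ is weakly convergent if $\lim_np(G_n,\alpha)$ exists for every $\alpha\in\mathcal A^D$. A closed path $(e_1,\dots,e_j)$ (sequence of consecutive edges returning to its starting vertex) is reduced if $e_{i+1}\ne\bar e_i$ for $1\le i\le j-1$ and $\bar e_1\ne e_j$, where $\bar e$ is the reversed edge. $N_j^G(x)$ is the number of reduced closed paths of length $j$ in $G$ starting at $x$. For a finite graph $H$: $Z_{H,{\rm norm}}(u)=\exp\bigl(\sum_{j\ge1}\frac{1}{j}\bigl(\frac{1}{|V_H|}\sum_{x\in V_H}N_j^H(x)\bigr)u^j\bigr)$, and $Z_{H,{\rm norm}}^{\mathfrak v}$ denotes the exponential of $\mathfrak v$ times the same power series. For the periodic graph: $Z_{(G,\Gamma)}(u)=\exp\bigl(\sum_{j\ge1}\frac{1}{j}\bigl(\sum_{x\in F}\frac{N_j^G(x)}{|\Gamma_x|}\bigr)u^j\bigr)$ (independent of the choice of $F$). *)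

theory Defs
  imports
    "HOL-Analysis.Analysis"
    "HOL-Algebra.Group_Action"
    "HOL-Combinatorics.Permutations"
    "Graph_Theory.Graph_Theory"
begin

section \<open>Graphs\<close>

text \<open>
  An undirected graph without loops and multiple edges is a symmetric loop-free set of pairs:
  \<open>pair_bidirected_digraph\<close>. An unoriented edge is a pair of opposite arcs, and the reversed edge of
  \<open>e\<close> is \<open>prod.swap e\<close>. The vertex set may be infinite.
\<close>

text \<open>The finiteness clause is needed because the cardinality of an infinite set is \<open>0\<close>.\<close>

definition degree_bounded :: "nat \<Rightarrow> 'v pair_pre_digraph \<Rightarrow> bool" where
  "degree_bounded D G \<longleftrightarrow>
     (\<forall>x\<in>pverts G. finite (out_arcs (with_proj G) x) \<and> out_degree (with_proj G) x \<le> D)"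

text \<open>Normalized quantities divide by the number of vertices, so a finite graph has a vertex.\<close>

definition finite_graph :: "'v pair_pre_digraph \<Rightarrow> bool" where
  "finite_graph H \<longleftrightarrow> pair_bidirected_digraph H \<and> finite (pverts H) \<and> pverts H \<noteq> {}"

definition graph_isomorphism ::
    "('v \<Rightarrow> 'w) \<Rightarrow> 'v pair_pre_digraph \<Rightarrow> 'w pair_pre_digraph \<Rightarrow> bool" where
  "graph_isomorphism f G H \<longleftrightarrow>
     bij_betw f (pverts G) (pverts H) \<and>
     (\<forall>x\<in>pverts G. \<forall>y\<in>pverts G. (x, y) \<in> parcs G \<longleftrightarrow> (f x, f y) \<in> parcs H)"

text \<open>The graph distance is the least number of edges of a walk (\<open>\<infinity>\<close> if there is none).\<close>

definition graph_dist :: "'v pair_pre_digraph \<Rightarrow> 'v \<Rightarrow> 'v \<Rightarrow> ereal" where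
  "graph_dist G = wf_digraph.\<mu> (with_proj G) (\<lambda>_. 1)"

definition induced_graph :: "'v pair_pre_digraph \<Rightarrow> 'v set \<Rightarrow> 'v pair_pre_digraph" where
  "induced_graph G S = \<lparr>pverts = S, parcs = {e \<in> parcs G. fst e \<in> S \<and> snd e \<in> S}\<rparr>"

lemma with_proj_induced_graph: "with_proj (induced_graph G S) = with_proj G \<restriction> S"
  by (simp add: induced_graph_def with_proj_def induce_subgraph_def)


section \<open>Rooted graphs and weak convergence\<close>

type_synonym 'v rooted_graph = "'v pair_pre_digraph \<times> 'v"

definition rooted_ball :: "'v pair_pre_digraph \<Rightarrow> ereal \<Rightarrow> 'v \<Rightarrow> 'v rooted_graph" where
  "rooted_ball G r x = (induced_graph G {y \<in> pverts G. graph_dist G x y \<le> r}, x)"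

definition radius :: "'v rooted_graph \<Rightarrow> ereal" where
  "radius A = Max (graph_dist (fst A) (snd A) ` pverts (fst A))"

text \<open>
  Every finite graph has an isomorphic copy with vertices in \<^typ>\<open>nat\<close>, so isomorphism classes of
  finite rooted graphs are formed over \<^typ>\<open>nat\<close>.
\<close>

definition rooted_graphs :: "nat \<Rightarrow> nat rooted_graph set" where
  "rooted_graphs D = {(A, a). finite_graph A \<and> Digraph_Component.connected (with_proj A) \<and>
     degree_bounded D A \<and> a \<in> pverts A}"

definition rooted_iso :: "nat \<Rightarrow> nat rooted_graph rel" where
  "rooted_iso D = {((A, a), (B, b)). (A, a) \<in> rooted_graphs D \<and> (B, b) \<in> rooted_graphs D \<and>
     (\<exists>f. graph_isomorphism f A B \<and> f a = b)}"

definition rooted_classes :: "nat \<Rightarrow> nat rooted_graph set set" where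
  "rooted_classes D = rooted_graphs D // rooted_iso D"

definition class_radius :: "nat rooted_graph set \<Rightarrow> ereal" where
  "class_radius \<alpha> = (THE r. \<forall>A\<in>\<alpha>. radius A = r)"

definition frequency :: "nat pair_pre_digraph \<Rightarrow> nat rooted_graph set \<Rightarrow> real" where
  "frequency H \<alpha> =
     real (card {x \<in> pverts H. rooted_ball H (class_radius \<alpha>) x \<in> \<alpha>}) / real (card (pverts H))"

definition weakly_convergent :: "nat \<Rightarrow> (nat \<Rightarrow> nat pair_pre_digraph) \<Rightarrow> bool" where
  "weakly_convergent D Gs \<longleftrightarrow>
     (\<forall>n. finite_graph (Gs n) \<and> degree_bounded D (Gs n)) \<and>
     (\<forall>\<alpha>\<in>rooted_classes D. convergent (\<lambda>n. frequency (Gs n) \<alpha>))"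


section \<open>Sofic groups\<close>

definition hamming_dist :: "nat \<Rightarrow> (nat \<Rightarrow> nat) \<Rightarrow> (nat \<Rightarrow> nat) \<Rightarrow> real" where
  "hamming_dist n \<sigma> \<tau> = real (card {a \<in> {1..n}. \<sigma> a \<noteq> \<tau> a}) / real n"

definition sofic_group :: "('g, 'm) monoid_scheme \<Rightarrow> bool" where
  "sofic_group \<Gamma> \<longleftrightarrow> group \<Gamma> \<and>
     (\<forall>T \<epsilon>. T \<subseteq> carrier \<Gamma> \<and> finite T \<and> \<epsilon> > 0 \<longrightarrow>
       (\<exists>n \<sigma>. n \<ge> 1 \<and> (\<forall>s\<in>T. \<sigma> s permutes {1..n}) \<and>
         (\<forall>s\<in>T. \<forall>t\<in>T. s \<otimes>\<^bsub>\<Gamma>\<^esub> t \<in> T \<longrightarrow> hamming_dist n (\<sigma> s \<circ> \<sigma> t) (\<sigma> (s \<otimes>\<^bsub>\<Gamma>\<^esub> t)) < \<epsilon>) \<and>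
         (\<one>\<^bsub>\<Gamma>\<^esub> \<in> T \<longrightarrow> hamming_dist n (\<sigma> \<one>\<^bsub>\<Gamma>\<^esub>) id < \<epsilon>) \<and>
         (\<forall>s\<in>T. \<forall>t\<in>T. s \<noteq> t \<longrightarrow> hamming_dist n (\<sigma> s) (\<sigma> t) \<ge> 1 - \<epsilon>)))"


section \<open>Periodic graphs\<close>

text \<open>
  As in \<open>BijGroup\<close>, automorphisms are extensional (\<open>undefined\<close> off the vertex set), so that distinct
  elements are distinct automorphisms. Multiplication is composition.
\<close>

definition automorphism_group :: "'v pair_pre_digraph \<Rightarrow> ('v \<Rightarrow> 'v) monoid" where
  "automorphism_group G =
     BijGroup (pverts G) \<lparr>carrier := {f \<in> Bij (pverts G). graph_isomorphism f G G}\<rparr>"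

abbreviation subgroup_of_aut :: "'v pair_pre_digraph \<Rightarrow> ('v \<Rightarrow> 'v) set \<Rightarrow> ('v \<Rightarrow> 'v) monoid" where
  "subgroup_of_aut G \<Gamma> \<equiv> automorphism_group G \<lparr>carrier := \<Gamma>\<rparr>"

abbreviation vertex_stabilizer ::
    "'v pair_pre_digraph \<Rightarrow> ('v \<Rightarrow> 'v) set \<Rightarrow> 'v \<Rightarrow> ('v \<Rightarrow> 'v) set" where
  "vertex_stabilizer G \<Gamma> x \<equiv> stabilizer (subgroup_of_aut G \<Gamma>) (\<lambda>\<gamma>. \<gamma>) x"

definition fundamental_domain ::
    "'v pair_pre_digraph \<Rightarrow> ('v \<Rightarrow> 'v) set \<Rightarrow> 'v set \<Rightarrow> bool" where
  "fundamental_domain G \<Gamma> F \<longleftrightarrow>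
     F \<subseteq> pverts G \<and>
     (\<forall>X\<in>orbits (subgroup_of_aut G \<Gamma>) (pverts G) (\<lambda>\<gamma>. \<gamma>). \<exists>!f. f \<in> F \<and> f \<in> X) \<and>
     (\<lambda>f. 1 / real (card (vertex_stabilizer G \<Gamma> f))) summable_on F"

definition covolume :: "'v pair_pre_digraph \<Rightarrow> ('v \<Rightarrow> 'v) set \<Rightarrow> 'v set \<Rightarrow> real" where
  "covolume G \<Gamma> F = (\<Sum>\<^sub>\<infinity>f\<in>F. 1 / real (card (vertex_stabilizer G \<Gamma> f)))"

definition periodic_graph :: "'v pair_pre_digraph \<Rightarrow> ('v \<Rightarrow> 'v) set \<Rightarrow> bool" where
  "periodic_graph G \<Gamma> \<longleftrightarrow>
     pair_bidirected_digraph G \<and> (\<exists>D. degree_bounded D G) \<and>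
     countable (pverts G) \<and> infinite (pverts G) \<and> Digraph_Component.connected (with_proj G) \<and>
     subgroup \<Gamma> (automorphism_group G) \<and> countable \<Gamma> \<and>
     (\<forall>x\<in>pverts G. finite (vertex_stabilizer G \<Gamma> x)) \<and>
     (\<exists>F. fundamental_domain G \<Gamma> F)"


section \<open>Ihara zeta functions\<close>

text \<open>
  The last clause is the condition that the reverse of the first edge is not the last edge; it is
  used for nonempty paths only.
\<close>

definition reduced_path :: "('v \<times> 'v) list \<Rightarrow> bool" where
  "reduced_path p \<longleftrightarrow>
     (\<forall>i. Suc i < length p \<longrightarrow> p ! Suc i \<noteq> prod.swap (p ! i)) \<and> prod.swap (hd p) \<noteq> last p"

definition num_reduced_closed_paths :: "'v pair_pre_digraph \<Rightarrow> nat \<Rightarrow> 'v \<Rightarrow> nat" where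
  "num_reduced_closed_paths G j x =
     card {p. pre_digraph.awalk (with_proj G) x p x \<and> length p = j \<and> reduced_path p}"

text \<open>The power series with coefficients \<open>c j / j\<close> for \<open>j \<ge> 1\<close>.\<close>

definition log_zeta_series :: "(nat \<Rightarrow> real) \<Rightarrow> complex \<Rightarrow> complex" where
  "log_zeta_series c u = (\<Sum>j. of_real (c (Suc j) / real (Suc j)) * u ^ Suc j)"

text \<open>
  The power \<open>Z\<^sup>v\<close> is the exponential of \<open>v\<close> times the series, not a choice of complex power of the
  value.
\<close>

definition Z_norm_pow :: "real \<Rightarrow> 'v pair_pre_digraph \<Rightarrow> complex \<Rightarrow> complex" where
  "Z_norm_pow v H u = exp (of_real v * log_zeta_series
     (\<lambda>j. (\<Sum>x\<in>pverts H. real (num_reduced_closed_paths H j x)) / real (card (pverts H))) u)"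

definition Z_periodic ::
    "'v pair_pre_digraph \<Rightarrow> ('v \<Rightarrow> 'v) set \<Rightarrow> 'v set \<Rightarrow> complex \<Rightarrow> complex" where
  "Z_periodic G \<Gamma> F u = exp (log_zeta_series
     (\<lambda>j. \<Sum>\<^sub>\<infinity>x\<in>F. real (num_reduced_closed_paths G j x) / real (card (vertex_stabilizer G \<Gamma> x))) u)"

end

theory Submission
  imports Defs
begin

text \<open>
The coefficient of \<open>u\<^sup>j\<close> in the logarithm of either zeta function is an average of the numbers
\<open>N\<^sub>j(x)\<close> of reduced closed paths, and \<open>N\<^sub>j(x)\<close> depends only on the ball of radius \<open>j\<close> about \<open>x\<close>. So
everything rests on finite graphs \<open>H\<close> whose balls have the statistics of the periodic graph \<open>G\<close>:
up to a small proportion, each vertex of \<open>H\<close> carries a label \<open>f \<in> F\<close> and has a large ball isomorphic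
to the ball of \<open>G\<close> about \<open>f\<close>, and label \<open>f\<close> occurs with frequency close to \<open>1 / (v |\<Gamma>\<^sub>f|)\<close>, where \<open>v\<close>
is the covolume.

Such \<open>H\<close> come from soficity. As a \<open>\<Gamma>\<close>-set, the vertex set of \<open>G\<close> is the disjoint union of the coset
spaces \<open>\<Gamma> / \<Gamma>\<^sub>f\<close>, where the vertex \<open>g f\<close> corresponds to \<open>g \<Gamma>\<^sub>f\<close>. A sofic approximation of \<open>\<Gamma>\<close> provides
a set \<open>{1..n}\<close> with a partially defined right action \<open>a \<cdot> s\<close> that obeys the group law and is free at
most points \<open>a\<close> (\<open>sofic_right_action\<close>). Replacing \<open>g\<close> by \<open>a \<cdot> g\<close> turns the coset of a vertex \<open>v\<close> into a
subset of \<open>{1..n}\<close>. For a fixed good point \<open>a\<close> this map, called \<open>sheet a\<close>, copies a finite piece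
\<open>K\<close> of \<open>G\<close>, and \<open>model\<close> is the union of all the copies. Two copies that share a vertex differ by the
action of one element of \<open>\<Gamma>\<close> (\<open>base_change\<close>); hence no vertex acquires additional neighbours, the
degree bound survives and \<open>sheet a\<close> is a local isomorphism wherever \<open>K\<close> contains the relevant ball
(\<open>model_local_iso\<close>). The vertices of \<open>model\<close>
with label \<open>f\<close> are disjoint subsets with \<open>|\<Gamma>\<^sub>f|\<close> elements that cover most of \<open>{1..n}\<close>, so their number is
close to \<open>n / |\<Gamma>\<^sub>f|\<close> (\<open>card_fibre_le\<close>, \<open>card_fibre_ge\<close>). If \<open>F\<close> is infinite, \<open>K\<close> is built from a finite
\<open>L \<subseteq> F\<close> that carries almost all of the covolume; the other orbits that \<open>K\<close> meets have small weight.

Letting the radius grow and the error shrink gives a sequence along which the average of every bounded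
local quantity converges (\<open>convergent_models_exist\<close>). Indicators of isomorphism classes of balls give
weak convergence; the numbers \<open>N\<^sub>j\<close> give convergence of each coefficient. Finally \<open>N\<^sub>j \<le> D (D - 1)\<^sup>j\<^sup>-\<^sup>1\<close>
dominates the power series on compact subsets of the disc, so Tannery's theorem turns
coefficientwise convergence into uniform convergence (\<open>uniform_limit_log_zeta_series\<close>).
\<close>

section \<open>Graphs as symmetric relations\<close>

text \<open>
All the graph-theoretic information that matters is local, so distances are replaced by iterated
neighbourhoods of the arc relation. These make sense for any relation, and this allows graphs over
different vertex types to be compared.
\<close>

definition rel_ball :: "'v rel \<Rightarrow> nat \<Rightarrow> 'v \<Rightarrow> 'v set" where
  "rel_ball E r x = {y. \<exists>k\<le>r. (x, y) \<in> E ^^ k}"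

lemma rel_ball_mono: "r \<le> s \<Longrightarrow> rel_ball E r x \<subseteq> rel_ball E s x"
  by (auto simp: rel_ball_def intro: order_trans)

lemma rel_ball_center: "x \<in> rel_ball E r x"
  by (auto simp: rel_ball_def intro!: exI[of _ 0])

lemma rel_ball_step: "v \<in> rel_ball E r x \<Longrightarrow> (v, w) \<in> E \<Longrightarrow> w \<in> rel_ball E (Suc r) x"
  unfolding rel_ball_def by (auto intro: relpow_Suc_I simp: Suc_le_mono)

lemma rel_ball_Suc: "rel_ball E (Suc r) x = insert x (\<Union>v\<in>rel_ball E r x. E `` {v})"
proof
  show "rel_ball E (Suc r) x \<subseteq> insert x (\<Union>v\<in>rel_ball E r x. E `` {v})"
  proof
    fix y assume "y \<in> rel_ball E (Suc r) x"
    then obtain k where "k \<le> Suc r" "(x, y) \<in> E ^^ k" by (auto simp: rel_ball_def)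
    then show "y \<in> insert x (\<Union>v\<in>rel_ball E r x. E `` {v})"
      by (cases k) (auto simp: rel_ball_def)
  qed
qed (auto intro: rel_ball_center rel_ball_step)

lemma rel_ball_in_verts:
  assumes "E \<subseteq> V \<times> V" "x \<in> V" shows "rel_ball E r x \<subseteq> V"
  using assms by (induction r) (auto simp: rel_ball_Suc rel_ball_def[of E 0])

lemma finite_rel_ball:
  assumes "\<And>v. v \<in> V \<Longrightarrow> finite (E `` {v})" "E \<subseteq> V \<times> V" "x \<in> V"
  shows "finite (rel_ball E r x)"
proof (induction r)
  case 0
  then show ?case by (simp add: rel_ball_def)
next
  case (Suc r)
  then show ?case
    using assms(1) rel_ball_in_verts[OF assms(2,3), of r] by (auto simp: rel_ball_Suc)
qed

lemma pair_bidirected_digraph_iff: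
  "pair_bidirected_digraph G \<longleftrightarrow>
     parcs G \<subseteq> pverts G \<times> pverts G \<and> sym (parcs G) \<and> (\<forall>x. (x, x) \<notin> parcs G)"
  by (auto simp: pair_bidirected_digraph_def pair_sym_digraph_def pair_wf_digraph_def
      pair_sym_digraph_axioms_def pair_loopfree_digraph_def pair_loopfree_digraph_axioms_def
      symmetric_def)

lemma degree_bounded_iff:
  "degree_bounded D G \<longleftrightarrow>
     (\<forall>x\<in>pverts G. finite (parcs G `` {x}) \<and> card (parcs G `` {x}) \<le> D)"
proof -
  have "out_arcs (with_proj G) x = Pair x ` (parcs G `` {x})" for x
    by (auto simp: out_arcs_def)
  then show ?thesis
    by (auto simp: degree_bounded_def out_degree_def card_image inj_on_def finite_image_iff)
qed

lemma awalk_with_proj_iff: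
  "pre_digraph.awalk (with_proj G) u p v \<longleftrightarrow> u \<in> pverts G \<and> set p \<subseteq> parcs G \<and> pcas u p v"
  by (simp add: pre_digraph.awalk_def cas_with_proj_eq)

lemma relpow_iff_pcas:
  "(u, v) \<in> E ^^ k \<longleftrightarrow> (\<exists>p. length p = k \<and> set p \<subseteq> E \<and> pcas u p v)"
proof (induction k arbitrary: u)
  case 0
  then show ?case by auto
next
  case (Suc k)
  have "(u, v) \<in> E ^^ Suc k \<longleftrightarrow> (\<exists>w. (u, w) \<in> E \<and> (w, v) \<in> E ^^ k)"
    by (metis relpow_Suc_D2 relpow_Suc_I2)
  also have "\<dots> \<longleftrightarrow> (\<exists>p. length p = Suc k \<and> set p \<subseteq> E \<and> pcas u p v)"
    unfolding Suc.IH by (force simp: length_Suc_conv)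
  finally show ?case .
qed

text \<open>
The distance is an infimum over walks; since walks of length \<open>k\<close> are the \<open>k\<close>-th power of the arc
relation, it is determined by the relation alone and is a natural number once it is finite.
\<close>

lemma graph_dist_eq:
  assumes "pair_bidirected_digraph G" "x \<in> pverts G"
  shows "graph_dist G x y = (INF k\<in>{k. (x, y) \<in> parcs G ^^ k}. ereal (real k))"
proof -
  have wf: "wf_digraph (with_proj G)"
    using assms(1) wf_digraph_wp_iff
    by (auto simp: pair_bidirected_digraph_def pair_sym_digraph_def)
  have "(\<lambda>p. ereal (real (length p))) ` {p. pre_digraph.awalk (with_proj G) x p y}
      = (\<lambda>k. ereal (real k)) ` {k. (x, y) \<in> parcs G ^^ k}"
    using assms(2) by (auto simp: relpow_iff_pcas awalk_with_proj_iff)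
  then show ?thesis
    by (simp add: graph_dist_def wf_digraph.\<mu>_def[OF wf] wf_digraph.awalk_cost_def[OF wf]
        sum_list_triv)
qed

lemma graph_dist_eq_Least:
  assumes "pair_bidirected_digraph G" "x \<in> pverts G" "(x, y) \<in> parcs G ^^ k"
  shows "graph_dist G x y = ereal (real (LEAST k. (x, y) \<in> parcs G ^^ k))"
  unfolding graph_dist_eq[OF assms(1,2)]
proof (rule INF_eqI)
  fix z assume "\<And>i. i \<in> {k. (x, y) \<in> parcs G ^^ k} \<Longrightarrow> z \<le> ereal (real i)"
  then show "z \<le> ereal (real (LEAST k. (x, y) \<in> parcs G ^^ k))"
    using LeastI[of "\<lambda>k. (x, y) \<in> parcs G ^^ k", OF assms(3)] by blast
qed (simp add: Least_le)

lemma graph_dist_le_iff: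
  assumes "pair_bidirected_digraph G" "x \<in> pverts G"
  shows "graph_dist G x y \<le> ereal (real r) \<longleftrightarrow> y \<in> rel_ball (parcs G) r x"
proof (cases "\<exists>k. (x, y) \<in> parcs G ^^ k")
  case True
  then obtain k where k: "(x, y) \<in> parcs G ^^ k" by blast
  show ?thesis
    unfolding graph_dist_eq_Least[OF assms k] rel_ball_def
    using LeastI[of "\<lambda>k. (x, y) \<in> parcs G ^^ k", OF k]
    by (auto intro: Least_le order_trans)
next
  case False
  then show ?thesis
    using graph_dist_eq[OF assms, of y] by (simp add: rel_ball_def top_ereal_def)
qed

lemma rooted_ball_eq:
  assumes "pair_bidirected_digraph G" "x \<in> pverts G"
  shows "rooted_ball G (ereal (real r)) x = (induced_graph G (rel_ball (parcs G) r x), x)"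
proof -
  have "rel_ball (parcs G) r x \<subseteq> pverts G"
    using rel_ball_in_verts assms by (metis pair_bidirected_digraph_iff)
  then have "{y \<in> pverts G. graph_dist G x y \<le> ereal (real r)} = rel_ball (parcs G) r x"
    using graph_dist_le_iff[OF assms] by auto
  then show ?thesis
    by (simp add: rooted_ball_def)
qed

lemma connected_iff_rtrancl:
  assumes "pair_bidirected_digraph G"
  shows "Digraph_Component.connected (with_proj G) \<longleftrightarrow>
    pverts G \<noteq> {} \<and> (\<forall>u\<in>pverts G. \<forall>v\<in>pverts G. (u, v) \<in> (parcs G)\<^sup>*)"
proof -
  have E: "parcs G \<subseteq> pverts G \<times> pverts G" "sym (parcs G)"
    using assms by (auto simp: pair_bidirected_digraph_iff)
  have s: "(parcs G)\<^sup>s = parcs G"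
    using E(2) by (auto simp: symcl_def dest: symD)
  have "(u, v) \<in> rtrancl_on (pverts G) (parcs G) \<longleftrightarrow> (u, v) \<in> (parcs G)\<^sup>*"
    if u: "u \<in> pverts G" for u v
  proof
    assume "(u, v) \<in> rtrancl_on (pverts G) (parcs G)"
    then show "(u, v) \<in> (parcs G)\<^sup>*"
      by (induction rule: rtrancl_on_induct) (auto intro: rtrancl_into_rtrancl)
  next
    assume "(u, v) \<in> (parcs G)\<^sup>*"
    then show "(u, v) \<in> rtrancl_on (pverts G) (parcs G)"
      by (induction rule: rtrancl_induct)
        (use u E(1) in \<open>auto intro: rtrancl_on_into_rtrancl_on\<close>)
  qed
  then show ?thesis
    by (simp add: connected_conv s)
qed

text \<open>
A walk of length at most \<open>r\<close> from the root does not leave the ball.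
\<close>

lemma rooted_ball_connected:
  assumes E: "pair_bidirected_digraph G" and x: "x \<in> pverts G"
  shows "Digraph_Component.connected (with_proj (induced_graph G (rel_ball (parcs G) r x)))"
proof -
  define B where "B = rel_ball (parcs G) r x"
  define I where "I = induced_graph G B"
  have I: "pverts I = B" "parcs I = {e \<in> parcs G. fst e \<in> B \<and> snd e \<in> B}"
    by (auto simp: I_def induced_graph_def)
  have bid: "pair_bidirected_digraph I"
    using E unfolding pair_bidirected_digraph_iff I by (auto simp: sym_def)
  have *: "(x, y) \<in> (parcs I)\<^sup>*" if "k \<le> r" "(x, y) \<in> parcs G ^^ k" for k y
    using that
  proof (induction k arbitrary: y)
    case (Suc k)
    then obtain z where z: "(x, z) \<in> parcs G ^^ k" "(z, y) \<in> parcs G" by auto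
    have "z \<in> B" "y \<in> B"
      using z Suc.prems Suc_leD[OF Suc.prems(1)] unfolding B_def rel_ball_def by blast+
    then have "(z, y) \<in> parcs I" using z by (auto simp: I)
    then show ?case using Suc.IH[OF _ z(1)] Suc.prems by (auto intro: rtrancl_into_rtrancl)
  qed auto
  have "(x, y) \<in> (parcs I)\<^sup>*" if "y \<in> B" for y
    using * that unfolding B_def rel_ball_def by blast
  moreover have "(y, x) \<in> (parcs I)\<^sup>*" if "(x, y) \<in> (parcs I)\<^sup>*" for y
    using that bid by (meson pair_bidirected_digraph_iff sym_rtrancl symD)
  ultimately have "(y, z) \<in> (parcs I)\<^sup>*" if "y \<in> B" "z \<in> B" for y z
    using that by (meson rtrancl_trans)
  then show ?thesis
    using connected_iff_rtrancl[OF bid] rel_ball_center[of x "parcs G" r] I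
    unfolding I_def B_def by auto
qed

lemma rooted_ball_in_rooted_graphs:
  assumes H: "finite_graph H" "degree_bounded D H" and x: "x \<in> pverts H"
  shows "rooted_ball H (ereal (real r)) x \<in> rooted_graphs D"
proof -
  have bid: "pair_bidirected_digraph H" using H by (simp add: finite_graph_def)
  define B where "B = rel_ball (parcs H) r x"
  define I where "I = induced_graph H B"
  have I: "pverts I = B" "parcs I = {e \<in> parcs H. fst e \<in> B \<and> snd e \<in> B}"
    by (auto simp: I_def induced_graph_def)
  have B: "B \<subseteq> pverts H" "x \<in> B"
    using bid x rel_ball_in_verts rel_ball_center unfolding B_def pair_bidirected_digraph_iff
    by metis+
  have "pair_bidirected_digraph I"
    using bid unfolding pair_bidirected_digraph_iff I by (auto simp: sym_def)
  then have "finite_graph I"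
    using H B finite_subset unfolding finite_graph_def I by auto
  moreover have "degree_bounded D I"
    unfolding degree_bounded_iff
  proof
    fix v assume v: "v \<in> pverts I"
    have sub: "parcs I `` {v} \<subseteq> parcs H `` {v}" by (auto simp: I)
    moreover have "finite (parcs H `` {v})" "card (parcs H `` {v}) \<le> D"
      using H(2) v B by (auto simp: degree_bounded_iff I)
    ultimately show "finite (parcs I `` {v}) \<and> card (parcs I `` {v}) \<le> D"
      by (meson card_mono finite_subset order_trans)
  qed
  moreover have "Digraph_Component.connected (with_proj I)"
    using rooted_ball_connected[OF bid x] by (simp add: I_def B_def)
  ultimately show ?thesis
    using B I(1) unfolding rooted_ball_eq[OF bid x] by (auto simp: rooted_graphs_def I_def B_def)
qed

section \<open>Local isomorphisms\<close>

text \<open>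
Injectivity on the ball of radius \<open>R + 1\<close> and a bijection between the neighbours of each vertex of the
ball of radius \<open>R\<close> can be checked one vertex at a time, without knowing the ball in the target
graph. They force \<open>\<pi>\<close> to be an isomorphism of the balls of radius \<open>R\<close>, and they determine all walks of length
at most \<open>R + 1\<close> that start at the root.
\<close>

definition local_iso ::
    "nat \<Rightarrow> 'v rel \<Rightarrow> 'v \<Rightarrow> 'w rel \<Rightarrow> 'w \<Rightarrow> ('v \<Rightarrow> 'w) \<Rightarrow> bool" where
  "local_iso R E x E' x' \<pi> \<longleftrightarrow> \<pi> x = x' \<and> inj_on \<pi> (rel_ball E (Suc R) x) \<and>
     (\<forall>v\<in>rel_ball E R x. E' `` {\<pi> v} = \<pi> ` (E `` {v}))"

lemma local_isoD:
  assumes "local_iso R E x E' x' \<pi>"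
  shows "\<pi> x = x'" "inj_on \<pi> (rel_ball E (Suc R) x)"
    "v \<in> rel_ball E R x \<Longrightarrow> E' `` {\<pi> v} = \<pi> ` (E `` {v})"
  using assms unfolding local_iso_def by blast+

lemma local_iso_mono:
  assumes "local_iso R E x E' x' \<pi>" "r \<le> R"
  shows "local_iso r E x E' x' \<pi>"
proof -
  have "rel_ball E r x \<subseteq> rel_ball E R x" "rel_ball E (Suc r) x \<subseteq> rel_ball E (Suc R) x"
    using assms(2) by (simp_all add: rel_ball_mono)
  then show ?thesis
    using assms(1) unfolding local_iso_def by (meson inj_on_subset subsetD)
qed

lemma local_iso_rel_ball:
  assumes "local_iso R E x E' x' \<pi>" "r \<le> Suc R"
  shows "rel_ball E' r x' = \<pi> ` rel_ball E r x"
  using assms(2)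
proof (induction r)
  case 0
  then show ?case using local_isoD(1)[OF assms(1)] by (simp add: rel_ball_def)
next
  case (Suc r)
  have "rel_ball E r x \<subseteq> rel_ball E R x" using Suc.prems by (intro rel_ball_mono) simp
  then have "(\<Union>v\<in>rel_ball E r x. E' `` {\<pi> v}) = (\<Union>v\<in>rel_ball E r x. \<pi> ` (E `` {v}))"
    using local_isoD(3)[OF assms(1)] by (intro SUP_cong) auto
  moreover have "rel_ball E' r x' = \<pi> ` rel_ball E r x" using Suc by simp
  ultimately show ?case
    unfolding rel_ball_Suc image_insert image_UN local_isoD(1)[OF assms(1)] by simp
qed

lemma local_iso_arc_iff:
  assumes "local_iso R E x E' x' \<pi>" "v \<in> rel_ball E R x" "w \<in> rel_ball E (Suc R) x"
  shows "(\<pi> v, \<pi> w) \<in> E' \<longleftrightarrow> (v, w) \<in> E"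
proof -
  have sub: "E `` {v} \<subseteq> rel_ball E (Suc R) x"
    using rel_ball_step[OF assms(2)] by blast
  have "(\<pi> v, \<pi> w) \<in> E' \<longleftrightarrow> \<pi> w \<in> \<pi> ` (E `` {v})"
    using local_isoD(3)[OF assms(1,2)] by blast
  also have "\<dots> \<longleftrightarrow> w \<in> E `` {v}"
    by (rule inj_on_image_mem_iff[OF local_isoD(2)[OF assms(1)] assms(3) sub])
  finally show ?thesis by simp
qed

lemma local_iso_graph_isomorphism:
  assumes "local_iso R (parcs G) x (parcs H) x' \<pi>" "r \<le> R"
  shows "graph_isomorphism \<pi> (induced_graph G (rel_ball (parcs G) r x))
    (induced_graph H (rel_ball (parcs H) r x'))"
proof -
  have l: "local_iso r (parcs G) x (parcs H) x' \<pi>"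
    by (rule local_iso_mono[OF assms])
  have b: "rel_ball (parcs H) r x' = \<pi> ` rel_ball (parcs G) r x"
    using local_iso_rel_ball[OF l, of r] by simp
  have i: "inj_on \<pi> (rel_ball (parcs G) r x)"
    by (rule inj_on_subset[OF local_isoD(2)[OF l] rel_ball_mono]) simp
  have "(\<pi> v, \<pi> w) \<in> parcs H \<longleftrightarrow> (v, w) \<in> parcs G"
    if "v \<in> rel_ball (parcs G) r x" "w \<in> rel_ball (parcs G) r x" for v w
    using local_iso_arc_iff[OF l that(1)] that(2) rel_ball_mono[of r "Suc r" "parcs G" x] by auto
  then show ?thesis
    using i unfolding graph_isomorphism_def induced_graph_def b by (simp add: bij_betw_def)
qed


text \<open>
Walks of length at most \<open>R + 1\<close> from the root can be pushed forward and, by the next lemma, lifted: all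
of their arcs start in the ball of radius \<open>R\<close>. The index \<open>i\<close> counts the steps already taken from the root.
\<close>

lemma local_iso_walk:
  assumes l: "local_iso R E x E' x' \<pi>"
    and "(x, u) \<in> E ^^ i" "i + length p \<le> Suc R" "set p \<subseteq> E" "pcas u p w"
  shows "set (map (map_prod \<pi> \<pi>) p) \<subseteq> E' \<and> pcas (\<pi> u) (map (map_prod \<pi> \<pi>) p) (\<pi> w) \<and>
    set p \<subseteq> rel_ball E (Suc R) x \<times> rel_ball E (Suc R) x \<and> w \<in> rel_ball E (Suc R) x"
  using assms(2-)
proof (induction p arbitrary: i u)
  case Nil
  then show ?case by (auto simp: rel_ball_def)
next
  case (Cons e p)
  obtain v where e: "e = (u, v)" "(u, v) \<in> E" using Cons.prems by (cases e) auto
  have iv: "(x, v) \<in> E ^^ Suc i" using Cons.prems e by auto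
  have u: "u \<in> rel_ball E R x" using Cons.prems by (auto simp: rel_ball_def intro!: exI[of _ i])
  have uv: "u \<in> rel_ball E (Suc R) x" "v \<in> rel_ball E (Suc R) x"
    using u rel_ball_mono[of R "Suc R" E x] rel_ball_step[OF u e(2)] by auto
  have "(\<pi> u, \<pi> v) \<in> E'" using local_iso_arc_iff[OF l u uv(2)] e by simp
  then show ?case using Cons.IH[OF iv] Cons.prems e uv by auto
qed

lemma local_iso_walk_lift:
  assumes l: "local_iso R E x E' x' \<pi>"
    and "(x, u) \<in> E ^^ i" "i + length q \<le> Suc R" "set q \<subseteq> E'" "pcas (\<pi> u) q z"
  shows "\<exists>p w. set p \<subseteq> E \<and> pcas u p w \<and> q = map (map_prod \<pi> \<pi>) p \<and> z = \<pi> w"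
  using assms(2-)
proof (induction q arbitrary: i u)
  case Nil
  then show ?case by (auto intro!: exI[of _ "[]"])
next
  case (Cons e q)
  obtain y where e: "e = (\<pi> u, y)" "(\<pi> u, y) \<in> E'" using Cons.prems by (cases e) auto
  have u: "u \<in> rel_ball E R x" using Cons.prems by (auto simp: rel_ball_def intro!: exI[of _ i])
  then have "y \<in> \<pi> ` (E `` {u})" using local_isoD(3)[OF l] e by blast
  then obtain v where v: "(u, v) \<in> E" "y = \<pi> v" by auto
  have "(x, v) \<in> E ^^ Suc i" using Cons.prems v by auto
  from Cons.IH[OF this] obtain p w where
    "set p \<subseteq> E" "pcas v p w" "q = map (map_prod \<pi> \<pi>) p" "z = \<pi> w"
    using Cons.prems e v by auto
  then show ?case
    using v e by (intro exI[of _ "(u, v) # p"] exI[of _ w]) auto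
qed

lemma reduced_path_map:
  assumes "inj_on \<pi> B" "set p \<subseteq> B \<times> B" "p \<noteq> []"
  shows "reduced_path (map (map_prod \<pi> \<pi>) p) \<longleftrightarrow> reduced_path p"
proof -
  have *: "map_prod \<pi> \<pi> e = prod.swap (map_prod \<pi> \<pi> e') \<longleftrightarrow> e = prod.swap e'"
    if "e \<in> set p" "e' \<in> set p" for e e'
  proof -
    have "e \<in> B \<times> B" "e' \<in> B \<times> B" using that assms(2) by auto
    then show ?thesis using inj_on_eq_iff[OF assms(1)] by (cases e; cases e') auto
  qed
  then have "prod.swap (map_prod \<pi> \<pi> (hd p)) = map_prod \<pi> \<pi> (last p)
      \<longleftrightarrow> prod.swap (hd p) = last p"
    using assms(3) by (metis hd_in_set last_in_set)
  with * show ?thesis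
    using assms(3) by (auto simp: reduced_path_def hd_map last_map)
qed

text \<open>
The end of the lift of a closed walk lies over the root within the ball of radius \<open>R + 1\<close>, so by
injectivity it is the root: lifts of closed walks are closed. Reducedness only compares arcs
inside that ball, where \<open>\<pi>\<close> is injective.
\<close>

lemma local_iso_num_reduced_closed_paths:
  assumes l: "local_iso R (parcs G) x (parcs H) x' \<pi>"
    and j: "0 < j" "j \<le> Suc R" and x: "x \<in> pverts G" "x' \<in> pverts H"
  shows "num_reduced_closed_paths H j x' = num_reduced_closed_paths G j x"
proof -
  define B where "B = rel_ball (parcs G) (Suc R) x"
  define P where "P = {p. set p \<subseteq> parcs G \<and> pcas x p x \<and> length p = j \<and> reduced_path p}"
  define Q where "Q = {p. set p \<subseteq> parcs H \<and> pcas x' p x' \<and> length p = j \<and> reduced_path p}"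
  have \<pi>x: "\<pi> x = x'" and inj: "inj_on \<pi> B"
    using local_isoD[OF l] by (simp_all add: B_def)
  have PB: "set p \<subseteq> B \<times> B" if "p \<in> P" for p
    using local_iso_walk[OF l, of x 0 p x] that j by (auto simp: P_def B_def)
  have "inj_on (map (map_prod \<pi> \<pi>)) P"
  proof (rule inj_onI)
    fix p q assume pq: "p \<in> P" "q \<in> P" "map (map_prod \<pi> \<pi>) p = map (map_prod \<pi> \<pi>) q"
    have "inj_on (map_prod \<pi> \<pi>) (set p \<union> set q)"
      using PB[OF pq(1)] PB[OF pq(2)]
      by (intro inj_on_subset[OF map_prod_inj_on[OF inj inj]]) blast
    then show "p = q"
      using pq(3) by (simp add: inj_on_map_eq_map)
  qed
  moreover have "map (map_prod \<pi> \<pi>) ` P = Q"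
  proof (intro equalityI subsetI)
    fix q assume "q \<in> map (map_prod \<pi> \<pi>) ` P"
    then obtain p where p: "p \<in> P" "q = map (map_prod \<pi> \<pi>) p" by auto
    have "p \<noteq> []" using p(1) j by (auto simp: P_def)
    then have "reduced_path q"
      using reduced_path_map[OF inj PB[OF p(1)]] p by (auto simp: P_def)
    moreover have "set q \<subseteq> parcs H \<and> pcas x' q x'"
      using local_iso_walk[OF l, of x 0 p x] p j \<pi>x by (auto simp: P_def)
    ultimately show "q \<in> Q" using p by (auto simp: Q_def P_def)
  next
    fix q assume q: "q \<in> Q"
    then obtain p w where p: "set p \<subseteq> parcs G" "pcas x p w" "q = map (map_prod \<pi> \<pi>) p" "x' = \<pi> w"
      using local_iso_walk_lift[OF l, of x 0 q x'] j \<pi>x by (auto simp: Q_def)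
    have len: "length p = j" "p \<noteq> []" using p q j by (auto simp: Q_def)
    have pB: "set p \<subseteq> B \<times> B" "w \<in> B"
      using local_iso_walk[OF l, of x 0 p w] p j len by (auto simp: B_def)
    then have "w = x"
      using inj_onD[OF inj, of w x] p(4) \<pi>x rel_ball_center[of x "parcs G" "Suc R"]
      by (simp add: B_def)
    moreover have "reduced_path p"
      using reduced_path_map[OF inj pB(1) len(2)] q p by (auto simp: Q_def)
    ultimately have "p \<in> P" using p len by (auto simp: P_def)
    then show "q \<in> map (map_prod \<pi> \<pi>) ` P" using p by auto
  qed
  ultimately have "card Q = card P" by (metis card_image)
  then show ?thesis
    using x by (simp add: num_reduced_closed_paths_def awalk_with_proj_iff P_def Q_def)
qed

section \<open>The number of reduced closed paths\<close>

text \<open>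
Dropping the condition on the first and the last arc of a reduced path, and letting its end vary, gives a
larger set of paths that can be counted by induction on the length.
\<close>

definition nonbacktracking :: "('v \<times> 'v) list \<Rightarrow> bool" where
  "nonbacktracking p \<longleftrightarrow> (\<forall>i. Suc i < length p \<longrightarrow> p ! Suc i \<noteq> prod.swap (p ! i))"

lemma nonbacktracking_Cons_Cons:
  "nonbacktracking (e # e' # p) \<longleftrightarrow> e' \<noteq> prod.swap e \<and> nonbacktracking (e' # p)"
  unfolding nonbacktracking_def by (auto simp: nth_Cons split: nat.splits)

definition nonbacktracking_continuations :: "'v rel \<Rightarrow> 'v \<times> 'v \<Rightarrow> nat \<Rightarrow> ('v \<times> 'v) list set" where
  "nonbacktracking_continuations E e j =
     {p. length p = j \<and> set p \<subseteq> E \<and> (\<exists>w. pcas (snd e) p w) \<and> nonbacktracking (e # p)}"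

text \<open>
The reverse of the last arc is always one of the at most \<open>D\<close> arcs that leave its end vertex, so each
step leaves at most \<open>D - 1\<close> choices.
\<close>

lemma card_nonbacktracking_continuations_le:
  assumes E: "sym E" and deg: "\<And>v. finite (E `` {v}) \<and> card (E `` {v}) \<le> D"
    and e: "e \<in> E"
  shows "finite (nonbacktracking_continuations E e j) \<and>
    card (nonbacktracking_continuations E e j) \<le> (D - 1) ^ j"
  using e
proof (induction j arbitrary: e)
  case 0
  have "nonbacktracking_continuations E e 0 = {[]}"
    by (auto simp: nonbacktracking_continuations_def nonbacktracking_def)
  then show ?case by simp
next
  case (Suc j)
  let ?S = "\<lambda>e. nonbacktracking_continuations E e j"
  define N where "N = Pair (snd e) ` (E `` {snd e} - {fst e})"
  have fN: "finite N" unfolding N_def using deg[of "snd e"] by auto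
  have "fst e \<in> E `` {snd e}" using Suc.prems E by (cases e) (auto dest: symD)
  then have cN: "card N \<le> D - 1"
    unfolding N_def using deg[of "snd e"]
    by (subst card_image) (auto simp: inj_on_def)
  have sub: "nonbacktracking_continuations E e (Suc j) \<subseteq> (\<Union>e'\<in>N. (#) e' ` ?S e')"
  proof
    fix p assume p: "p \<in> nonbacktracking_continuations E e (Suc j)"
    then obtain e' q where q: "p = e' # q"
      by (cases p) (auto simp: nonbacktracking_continuations_def)
    have "e' \<in> N"
      using p q unfolding N_def nonbacktracking_continuations_def
      by (cases e; cases e') (auto simp: nonbacktracking_Cons_Cons)
    moreover have "q \<in> ?S e'"
      using p q by (auto simp: nonbacktracking_Cons_Cons nonbacktracking_continuations_def)
    ultimately show "p \<in> (\<Union>e'\<in>N. (#) e' ` ?S e')" using q by blast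
  qed
  have IH: "finite (?S e')" "card (?S e') \<le> (D - 1) ^ j" if "e' \<in> N" for e'
    using Suc.IH[of e'] that unfolding N_def by blast+
  have fin: "finite (\<Union>e'\<in>N. (#) e' ` ?S e')" using fN IH(1) by blast
  have "card (nonbacktracking_continuations E e (Suc j)) \<le> card (\<Union>e'\<in>N. (#) e' ` ?S e')"
    by (rule card_mono[OF fin sub])
  also have "\<dots> \<le> (\<Sum>e'\<in>N. card ((#) e' ` ?S e'))"
    using fN by (rule card_UN_le)
  also have "\<dots> \<le> (\<Sum>e'\<in>N. (D - 1) ^ j)"
    by (rule sum_mono) (meson IH card_image_le order_trans)
  also have "\<dots> \<le> (D - 1) ^ Suc j"
    using cN by simp
  finally show ?case using finite_subset[OF sub fin] by simp
qed

text \<open>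
The first arc can be chosen in at most \<open>D\<close> ways. This estimate is the source of the radius
\<open>1 / (D - 1)\<close>.
\<close>

lemma num_reduced_closed_paths_le:
  assumes bid: "pair_bidirected_digraph G" and deg: "degree_bounded D G" and x: "x \<in> pverts G"
  shows "real (num_reduced_closed_paths G (Suc j) x) \<le> real D * real (D - 1) ^ j"
proof -
  let ?E = "parcs G"
  let ?S = "\<lambda>e. nonbacktracking_continuations ?E e j"
  have E: "?E \<subseteq> pverts G \<times> pverts G" "sym ?E" using bid by (auto simp: pair_bidirected_digraph_iff)
  have deg': "finite (?E `` {v}) \<and> card (?E `` {v}) \<le> D" for v
  proof (cases "v \<in> pverts G")
    case False
    then have "?E `` {v} = {}" using E by auto
    then show ?thesis by simp
  qed (use deg in \<open>auto simp: degree_bounded_iff\<close>)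
  define N where "N = Pair x ` (?E `` {x})"
  have N: "finite N" "card N \<le> D"
    unfolding N_def using deg'[of x] card_image_le[of "?E `` {x}" "Pair x"] by auto
  have S: "finite (?S e)" "card (?S e) \<le> (D - 1) ^ j" if "e \<in> N" for e
    using card_nonbacktracking_continuations_le[OF E(2) deg', of e j] that
    unfolding N_def by blast+
  have sub: "{p. pre_digraph.awalk (with_proj G) x p x \<and> length p = Suc j \<and> reduced_path p}
      \<subseteq> (\<Union>e\<in>N. (#) e ` ?S e)"
  proof
    fix p assume p: "p \<in> {p. pre_digraph.awalk (with_proj G) x p x \<and> length p = Suc j \<and> reduced_path p}"
    then obtain e q where q: "p = e # q" by (cases p) auto
    have *: "set p \<subseteq> ?E" "pcas x p x" "length q = j" "nonbacktracking (e # q)"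
      using p q by (auto simp: awalk_with_proj_iff reduced_path_def nonbacktracking_def)
    have "e \<in> N" using * q by (cases e) (auto simp: N_def)
    moreover have "q \<in> ?S e"
      using * q by (auto simp: nonbacktracking_continuations_def)
    ultimately show "p \<in> (\<Union>e\<in>N. (#) e ` ?S e)" using q by blast
  qed
  have fin: "finite (\<Union>e\<in>N. (#) e ` ?S e)" using N(1) S(1) by blast
  have "num_reduced_closed_paths G (Suc j) x \<le> card (\<Union>e\<in>N. (#) e ` ?S e)"
    unfolding num_reduced_closed_paths_def by (rule card_mono[OF fin sub])
  also have "\<dots> \<le> (\<Sum>e\<in>N. card ((#) e ` ?S e))"
    using N(1) by (rule card_UN_le)
  also have "\<dots> \<le> (\<Sum>e\<in>N. (D - 1) ^ j)"
    by (rule sum_mono) (meson S card_image_le order_trans)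
  also have "\<dots> \<le> D * (D - 1) ^ j"
    using N(2) by simp
  finally have "real (num_reduced_closed_paths G (Suc j) x) \<le> real (D * (D - 1) ^ j)"
    by (rule of_nat_mono)
  then show ?thesis by simp
qed

section \<open>Sofic groups\<close>

text \<open>
The point \<open>act a s\<close> is \<open>\<sigma> (inv s) a\<close>; taking inverses turns an approximate left action into an approximate
right action. A right action is needed because the left multiplications on the cosets
\<open>g \<Gamma>\<^sub>f\<close> must remain symmetries, while an arc leads from \<open>g \<Gamma>\<^sub>f\<close> to a coset \<open>g s \<Gamma>\<^sub>f\<^sub>'\<close>. Each of the
finitely many required identities and inequalities fails for a proportion of at most \<open>\<delta>\<close> of the
points; \<open>good\<close> consists of the points where none of them fails.
\<close>

lemma sofic_right_action:
  assumes sofic: "sofic_group \<Gamma>" and T: "finite T" "T \<subseteq> carrier \<Gamma>" and \<epsilon>: "\<epsilon> > 0"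
  obtains n :: nat and act :: "nat \<Rightarrow> 'g \<Rightarrow> nat" and good :: "nat set"
  where "n \<ge> 1" "good \<subseteq> {1..n}" "real (card good) \<ge> (1 - \<epsilon>) * real n"
    "\<And>a s. a \<in> {1..n} \<Longrightarrow> s \<in> T \<Longrightarrow> act a s \<in> {1..n}"
    "\<And>a s t. a \<in> good \<Longrightarrow> s \<in> T \<Longrightarrow> t \<in> T \<Longrightarrow> s \<otimes>\<^bsub>\<Gamma>\<^esub> t \<in> T \<Longrightarrow> act (act a s) t = act a (s \<otimes>\<^bsub>\<Gamma>\<^esub> t)"
    "\<And>a. a \<in> good \<Longrightarrow> act a \<one>\<^bsub>\<Gamma>\<^esub> = a"
    "\<And>a. a \<in> good \<Longrightarrow> inj_on (act a) T"
proof -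
  interpret group \<Gamma> using sofic by (simp add: sofic_group_def)
  define S where "S = insert \<one>\<^bsub>\<Gamma>\<^esub> ((\<lambda>s. inv\<^bsub>\<Gamma>\<^esub> s) ` T)"
  have S: "finite S" "S \<subseteq> carrier \<Gamma>" "\<one>\<^bsub>\<Gamma>\<^esub> \<in> S" and inv_S: "\<And>s. s \<in> T \<Longrightarrow> inv\<^bsub>\<Gamma>\<^esub> s \<in> S"
    using T by (auto simp: S_def)
  define \<delta> where "\<delta> = \<epsilon> / (2 * real (card S) ^ 2 + 1)"
  have \<delta>: "\<delta> > 0" unfolding \<delta>_def using \<epsilon> by (intro divide_pos_pos) (auto intro: add_nonneg_pos)
  have "\<exists>n \<sigma>. n \<ge> 1 \<and> (\<forall>s\<in>S. \<sigma> s permutes {1..n}) \<and>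
         (\<forall>s\<in>S. \<forall>t\<in>S. s \<otimes>\<^bsub>\<Gamma>\<^esub> t \<in> S \<longrightarrow> hamming_dist n (\<sigma> s \<circ> \<sigma> t) (\<sigma> (s \<otimes>\<^bsub>\<Gamma>\<^esub> t)) < \<delta>) \<and>
         (\<one>\<^bsub>\<Gamma>\<^esub> \<in> S \<longrightarrow> hamming_dist n (\<sigma> \<one>\<^bsub>\<Gamma>\<^esub>) id < \<delta>) \<and>
         (\<forall>s\<in>S. \<forall>t\<in>S. s \<noteq> t \<longrightarrow> hamming_dist n (\<sigma> s) (\<sigma> t) \<ge> 1 - \<delta>)"
    using sofic S(1,2) \<delta> unfolding sofic_group_def by blast
  then obtain n \<sigma> where n: "n \<ge> 1" and perm: "\<And>s. s \<in> S \<Longrightarrow> \<sigma> s permutes {1..n}"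
    and mult: "\<And>s t. s \<in> S \<Longrightarrow> t \<in> S \<Longrightarrow> s \<otimes>\<^bsub>\<Gamma>\<^esub> t \<in> S \<Longrightarrow>
        hamming_dist n (\<sigma> s \<circ> \<sigma> t) (\<sigma> (s \<otimes>\<^bsub>\<Gamma>\<^esub> t)) < \<delta>"
    and one: "hamming_dist n (\<sigma> \<one>\<^bsub>\<Gamma>\<^esub>) id < \<delta>"
    and sep: "\<And>s t. s \<in> S \<Longrightarrow> t \<in> S \<Longrightarrow> s \<noteq> t \<Longrightarrow> hamming_dist n (\<sigma> s) (\<sigma> t) \<ge> 1 - \<delta>"
    using S(3) by metis
  \<comment> \<open>Points where the unit moves something, the product law fails, or freeness fails.\<close>
  define B0 where "B0 = {a \<in> {1..n}. \<sigma> \<one>\<^bsub>\<Gamma>\<^esub> a \<noteq> id a}"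
  define B1 where "B1 = (\<lambda>(s, t). if s \<otimes>\<^bsub>\<Gamma>\<^esub> t \<in> S
    then {a \<in> {1..n}. (\<sigma> s \<circ> \<sigma> t) a \<noteq> \<sigma> (s \<otimes>\<^bsub>\<Gamma>\<^esub> t) a} else {})"
  define B2 where "B2 = (\<lambda>(s, t). if s \<noteq> t then {a \<in> {1..n}. \<sigma> s a = \<sigma> t a} else {})"
  define bad where "bad = B0 \<union> (\<Union>p\<in>S \<times> S. B1 p \<union> B2 p)"
  have dist: "real (card {a \<in> {1..n}. \<sigma>1 a \<noteq> \<sigma>2 a}) \<le> \<delta> * real n"
    if "hamming_dist n \<sigma>1 \<sigma>2 < \<delta>" for \<sigma>1 \<sigma>2
    using that n by (simp add: hamming_dist_def divide_less_eq split: if_splits)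
  have B0: "real (card B0) \<le> \<delta> * real n"
    unfolding B0_def by (rule dist[OF one])
  have B1: "real (card (B1 p)) \<le> \<delta> * real n" if "p \<in> S \<times> S" for p
    using that dist[OF mult] \<delta> by (auto simp: B1_def)
  have B2: "real (card (B2 p)) \<le> \<delta> * real n" if "p \<in> S \<times> S" for p
  proof -
    obtain s t where p: "p = (s, t)" "s \<in> S" "t \<in> S" using \<open>p \<in> S \<times> S\<close> by auto
    define X where "X = {a \<in> {1..n}. \<sigma> s a \<noteq> \<sigma> t a}"
    define Y where "Y = {a \<in> {1..n}. \<sigma> s a = \<sigma> t a}"
    have XY: "X \<union> Y = {1..n}" "X \<inter> Y = {}" by (auto simp: X_def Y_def)
    have fin: "finite X" "finite Y" by (simp_all add: X_def Y_def)
    have "card X + card Y = n"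
      using card_Un_disjoint[OF fin XY(2)] unfolding XY(1) by simp
    then have n': "real (card X) + real (card Y) = real n" by linarith
    show ?thesis
    proof (cases "s = t")
      case True
      then show ?thesis using \<delta> by (simp add: p(1) B2_def)
    next
      case False
      have "1 - \<delta> \<le> real (card X) / real n"
        using sep[OF p(2,3) False] by (simp add: hamming_dist_def X_def)
      then have "(1 - \<delta>) * real n \<le> real (card X)"
        using n by (simp add: le_divide_eq)
      then have "real (card Y) \<le> \<delta> * real n"
        using n' by (simp add: left_diff_distrib)
      moreover have "B2 p = Y" using False by (simp add: p(1) B2_def Y_def)
      ultimately show ?thesis by simp
    qed
  qed
  have fin: "finite (B1 p)" "finite (B2 p)" for p by (auto simp: B1_def B2_def split: prod.splits)
  have "card (\<Union>p\<in>S \<times> S. B1 p \<union> B2 p) \<le> (\<Sum>p\<in>S \<times> S. card (B1 p \<union> B2 p))"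
    using S(1) by (intro card_UN_le) auto
  then have "real (card (\<Union>p\<in>S \<times> S. B1 p \<union> B2 p)) \<le> (\<Sum>p\<in>S \<times> S. real (card (B1 p \<union> B2 p)))"
    by (metis of_nat_mono of_nat_sum)
  also have "\<dots> \<le> (\<Sum>p\<in>S \<times> S. 2 * (\<delta> * real n))"
  proof (rule sum_mono)
    fix p assume p: "p \<in> S \<times> S"
    have "real (card (B1 p \<union> B2 p)) \<le> real (card (B1 p)) + real (card (B2 p))"
      by (metis card_Un_le of_nat_add of_nat_mono)
    then show "real (card (B1 p \<union> B2 p)) \<le> 2 * (\<delta> * real n)"
      using B1[OF p] B2[OF p] by linarith
  qed
  also have "\<dots> = 2 * real (card S) ^ 2 * (\<delta> * real n)"
    by (simp add: card_cartesian_product power2_eq_square)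
  finally have "real (card bad) \<le> \<delta> * real n + 2 * real (card S) ^ 2 * (\<delta> * real n)"
    using B0 card_Un_le[of B0 "\<Union>p\<in>S \<times> S. B1 p \<union> B2 p"] unfolding bad_def by linarith
  also have "\<dots> = (2 * real (card S) ^ 2 + 1) * \<delta> * real n" by (simp add: algebra_simps)
  also have "(2 * real (card S) ^ 2 + 1) * \<delta> = \<epsilon>"
    unfolding \<delta>_def using add_nonneg_pos[of "2 * real (card S) ^ 2" 1] by simp
  finally have bad: "real (card bad) \<le> \<epsilon> * real n" .
  have bad_sub: "bad \<subseteq> {1..n}"
    by (auto simp: bad_def B0_def B1_def B2_def split: if_splits)
  define good where "good = {1..n} - bad"
  have "card good = n - card bad"
    unfolding good_def using bad_sub finite_subset[OF bad_sub] by (simp add: card_Diff_subset)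
  moreover have "card bad \<le> n" using card_mono[OF _ bad_sub] by simp
  ultimately have card_good: "real (card good) \<ge> (1 - \<epsilon>) * real n"
    using bad by (simp add: of_nat_diff algebra_simps)
  have good_mult: "\<sigma> s (\<sigma> t a) = \<sigma> (s \<otimes>\<^bsub>\<Gamma>\<^esub> t) a"
    if "a \<in> good" "s \<in> S" "t \<in> S" "s \<otimes>\<^bsub>\<Gamma>\<^esub> t \<in> S" for a s t
  proof -
    have "a \<notin> B1 (s, t)" "a \<in> {1..n}" using that by (auto simp: good_def bad_def)
    then show ?thesis using that(4) by (auto simp: B1_def)
  qed
  have good_inj: "s = t" if "a \<in> good" "s \<in> S" "t \<in> S" "\<sigma> s a = \<sigma> t a" for a s t
  proof (rule ccontr)
    assume "s \<noteq> t"
    moreover have "a \<notin> B2 (s, t)" "a \<in> {1..n}" using that by (auto simp: good_def bad_def)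
    ultimately show False using that(4) by (auto simp: B2_def)
  qed
  define act where "act = (\<lambda>a s. \<sigma> (inv\<^bsub>\<Gamma>\<^esub> s) a)"
  show thesis
  proof (rule that[of n good act])
    show "n \<ge> 1" "(1 - \<epsilon>) * real n \<le> real (card good)" by fact+
    show "good \<subseteq> {1..n}" by (auto simp: good_def)
    show "act a s \<in> {1..n}" if "a \<in> {1..n}" "s \<in> T" for a s
      using permutes_in_image[OF perm[OF inv_S[OF that(2)]]] that(1) by (simp add: act_def)
    show "act (act a s) t = act a (s \<otimes>\<^bsub>\<Gamma>\<^esub> t)"
      if "a \<in> good" "s \<in> T" "t \<in> T" "s \<otimes>\<^bsub>\<Gamma>\<^esub> t \<in> T" for a s t
    proof -
      have "inv\<^bsub>\<Gamma>\<^esub> (s \<otimes>\<^bsub>\<Gamma>\<^esub> t) = inv\<^bsub>\<Gamma>\<^esub> t \<otimes>\<^bsub>\<Gamma>\<^esub> inv\<^bsub>\<Gamma>\<^esub> s"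
        using that T by (intro inv_mult_group) auto
      then show ?thesis
        using good_mult[OF that(1) inv_S[OF that(3)] inv_S[OF that(2)]] inv_S[OF that(4)]
        by (simp add: act_def)
    qed
    show "act a \<one>\<^bsub>\<Gamma>\<^esub> = a" if "a \<in> good" for a
      using that by (auto simp: act_def good_def bad_def B0_def)
    show "inj_on (act a) T" if "a \<in> good" for a
    proof (rule inj_onI)
      fix s t assume st: "s \<in> T" "t \<in> T" "act a s = act a t"
      then have "inv\<^bsub>\<Gamma>\<^esub> s = inv\<^bsub>\<Gamma>\<^esub> t"
        using good_inj[OF that inv_S inv_S] by (simp add: act_def)
      then show "s = t" using st T inv_inv by (metis subsetD)
    qed
  qed
qed

section \<open>Finite models of a periodic graph\<close>

text \<open>
The elements of an automorphism group are themselves maps of vertices. The arguments about cosets use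
them only as group elements, so the action \<open>\<phi>\<close> is kept as a separate map.
\<close>

locale periodic_action = group \<Gamma> for \<Gamma> :: "('g, 'm) monoid_scheme" (structure) +
  fixes \<phi> :: "'g \<Rightarrow> 'v \<Rightarrow> 'v" and V :: "'v set" and E :: "'v rel" and F :: "'v set" and D :: nat
  assumes act_closed: "\<And>g v. g \<in> carrier \<Gamma> \<Longrightarrow> v \<in> V \<Longrightarrow> \<phi> g v \<in> V"
    and act_mult: "\<And>g h v. g \<in> carrier \<Gamma> \<Longrightarrow> h \<in> carrier \<Gamma> \<Longrightarrow> v \<in> V \<Longrightarrow> \<phi> (g \<otimes> h) v = \<phi> g (\<phi> h v)"
    and act_one: "\<And>v. v \<in> V \<Longrightarrow> \<phi> \<one> v = v"
    and arcs_in_verts: "E \<subseteq> V \<times> V"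
    and arcs_sym: "sym E"
    and no_loops: "\<And>v. (v, v) \<notin> E"
    and act_arc: "\<And>g v w. g \<in> carrier \<Gamma> \<Longrightarrow> (v, w) \<in> E \<Longrightarrow> (\<phi> g v, \<phi> g w) \<in> E"
    and finite_nbrs: "\<And>v. v \<in> V \<Longrightarrow> finite (E `` {v})"
    and degree_le: "\<And>v. v \<in> V \<Longrightarrow> card (E `` {v}) \<le> D"
    and finite_stabilizer: "\<And>v. v \<in> V \<Longrightarrow> finite (stabilizer \<Gamma> \<phi> v)"
    and domain_in_verts: "F \<subseteq> V"
    and domain_ex1: "\<And>v. v \<in> V \<Longrightarrow> \<exists>!f. f \<in> F \<and> (\<exists>g\<in>carrier \<Gamma>. \<phi> g f = v)"
    and domain_summable: "(\<lambda>f. 1 / real (card (stabilizer \<Gamma> \<phi> f))) summable_on F"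
begin

text \<open>
The point of \<open>F\<close> in the orbit of a vertex. Together with the transporter, the coset of all group elements
that move this point to the vertex, it identifies the vertex set with the union of the coset spaces.
\<close>

definition rep :: "'v \<Rightarrow> 'v" where
  "rep v = (THE f. f \<in> F \<and> (\<exists>g\<in>carrier \<Gamma>. \<phi> g f = v))"

definition transporter :: "'v \<Rightarrow> 'g set" where
  "transporter v = {g \<in> carrier \<Gamma>. \<phi> g (rep v) = v}"

lemma rep_unique: "f \<in> F \<Longrightarrow> g \<in> carrier \<Gamma> \<Longrightarrow> \<phi> g f = v \<Longrightarrow> rep v = f"
  using domain_ex1[of v] act_closed[of g f] domain_in_verts unfolding rep_def
  by (intro the1_equality) auto

lemma rep_in_domain: "v \<in> V \<Longrightarrow> rep v \<in> F"
  and transporter_nonempty: "v \<in> V \<Longrightarrow> transporter v \<noteq> {}"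
  using theI'[OF domain_ex1[of v]] unfolding rep_def transporter_def by auto

lemma transporter_carrier: "transporter v \<subseteq> carrier \<Gamma>"
  by (auto simp: transporter_def)

lemma rep_domain: "f \<in> F \<Longrightarrow> rep f = f"
  using rep_unique[of f \<one> f] act_one[of f] domain_in_verts by auto

lemma transporter_domain: "f \<in> F \<Longrightarrow> transporter f = stabilizer \<Gamma> \<phi> f"
  by (simp add: transporter_def stabilizer_def rep_domain)

lemma rep_act: "v \<in> V \<Longrightarrow> g \<in> carrier \<Gamma> \<Longrightarrow> rep (\<phi> g v) = rep v"
proof -
  assume v: "v \<in> V" and g: "g \<in> carrier \<Gamma>"
  obtain t where t: "t \<in> carrier \<Gamma>" "\<phi> t (rep v) = v"
    using transporter_nonempty[OF v] by (auto simp: transporter_def)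
  have "\<phi> (g \<otimes> t) (rep v) = \<phi> g v"
    using act_mult[OF g t(1)] t(2) rep_in_domain[OF v] domain_in_verts by auto
  then show ?thesis
    using rep_unique[OF rep_in_domain[OF v], of "g \<otimes> t"] g t(1) by auto
qed

lemma transporter_act:
  assumes v: "v \<in> V" and g: "g \<in> carrier \<Gamma>"
  shows "transporter (\<phi> g v) = (\<lambda>t. g \<otimes> t) ` transporter v"
proof (intro equalityI subsetI)
  have f: "rep v \<in> V" using rep_in_domain[OF v] domain_in_verts by auto
  fix t assume t: "t \<in> transporter (\<phi> g v)"
  then have tc: "t \<in> carrier \<Gamma>" "\<phi> t (rep v) = \<phi> g v"
    using rep_act[OF v g] by (auto simp: transporter_def)
  have "\<phi> (inv g \<otimes> t) (rep v) = \<phi> (inv g) (\<phi> g v)"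
    using act_mult[of "inv g" t "rep v"] tc g f by simp
  also have "\<dots> = v"
    using act_mult[of "inv g" g v] g v act_one by simp
  finally have "inv g \<otimes> t \<in> transporter v" using g tc by (auto simp: transporter_def)
  moreover have "t = g \<otimes> (inv g \<otimes> t)" using g tc by (simp add: m_assoc[symmetric])
  ultimately show "t \<in> (\<lambda>t. g \<otimes> t) ` transporter v" by blast
next
  have f: "rep v \<in> V" using rep_in_domain[OF v] domain_in_verts by auto
  fix t assume "t \<in> (\<lambda>t. g \<otimes> t) ` transporter v"
  then obtain s where "t = g \<otimes> s" "s \<in> carrier \<Gamma>" "\<phi> s (rep v) = v"
    by (auto simp: transporter_def)
  then show "t \<in> transporter (\<phi> g v)"
    using act_mult[OF g] rep_act[OF v g] g f by (auto simp: transporter_def)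
qed

lemma card_transporter:
  assumes v: "v \<in> V"
  shows "finite (transporter v)" "card (transporter v) = card (stabilizer \<Gamma> \<phi> (rep v))"
proof -
  obtain g where g: "g \<in> carrier \<Gamma>" "\<phi> g (rep v) = v"
    using transporter_nonempty[OF v] by (auto simp: transporter_def)
  have f: "rep v \<in> F" "rep v \<in> V" using rep_in_domain[OF v] domain_in_verts by auto
  have "transporter v = (\<lambda>t. g \<otimes> t) ` stabilizer \<Gamma> \<phi> (rep v)"
    using transporter_act[OF f(2) g(1)] g(2) transporter_domain[OF f(1)] by simp
  moreover have "inj_on (\<lambda>t. g \<otimes> t) (stabilizer \<Gamma> \<phi> (rep v))"
    using g(1) by (intro inj_onI) (auto simp: stabilizer_def)
  ultimately show "finite (transporter v)" "card (transporter v) = card (stabilizer \<Gamma> \<phi> (rep v))"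
    using finite_stabilizer[OF f(2)] by (simp_all add: card_image)
qed

lemma card_stabilizer_pos: "v \<in> V \<Longrightarrow> 0 < card (stabilizer \<Gamma> \<phi> v)"
proof -
  assume v: "v \<in> V"
  then have "\<one> \<in> stabilizer \<Gamma> \<phi> v" by (simp add: stabilizer_def act_one)
  then show ?thesis using finite_stabilizer[OF v] by (auto simp: card_gt_0_iff)
qed

end

text \<open>
The data for a finite model of the finite piece \<open>K\<close> of the graph. The set \<open>T\<close> has to contain the
transporters of \<open>K\<close> and the few words in them that occur when two copies of \<open>K\<close> are compared. The
injection \<open>enc\<close> makes the vertices of the model natural numbers.
\<close>

locale partial_sofic_model = periodic_action \<Gamma> \<phi> V E F D
  for \<Gamma> :: "('g, 'm) monoid_scheme" (structure) and \<phi> :: "'g \<Rightarrow> 'v \<Rightarrow> 'v" and V E F D +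
  fixes K :: "'v set" and T :: "'g set" and n :: nat and act :: "nat \<Rightarrow> 'g \<Rightarrow> nat"
    and good :: "nat set" and enc :: "'v \<times> nat set \<Rightarrow> nat"
  assumes K: "finite K" "K \<subseteq> V"
    and T: "finite T"
    and T_one: "\<one> \<in> T"
    and T_tr: "\<And>v g. v \<in> K \<Longrightarrow> g \<in> transporter v \<Longrightarrow> g \<in> T"
    and T_inv: "\<And>v g. v \<in> K \<Longrightarrow> g \<in> transporter v \<Longrightarrow> inv g \<in> T"
    and T_quot: "\<And>v w g h. v \<in> K \<Longrightarrow> g \<in> transporter v \<Longrightarrow> w \<in> K \<Longrightarrow> h \<in> transporter w \<Longrightarrow>
      g \<otimes> inv h \<in> T"
    and T_quot_mult: "\<And>u v w g h k. v \<in> K \<Longrightarrow> g \<in> transporter v \<Longrightarrow> w \<in> K \<Longrightarrow> h \<in> transporter w \<Longrightarrow>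
      u \<in> K \<Longrightarrow> k \<in> transporter u \<Longrightarrow> g \<otimes> inv h \<otimes> k \<in> T"
    and good_subset: "good \<subseteq> {1..n}"
    and act_range: "\<And>a s. a \<in> {1..n} \<Longrightarrow> s \<in> T \<Longrightarrow> act a s \<in> {1..n}"
    and good_mult: "\<And>a s t. a \<in> good \<Longrightarrow> s \<in> T \<Longrightarrow> t \<in> T \<Longrightarrow> s \<otimes> t \<in> T \<Longrightarrow>
      act (act a s) t = act a (s \<otimes> t)"
    and good_one: "\<And>a. a \<in> good \<Longrightarrow> act a \<one> = a"
    and good_inj: "\<And>a. a \<in> good \<Longrightarrow> inj_on (act a) T"
    and enc_inj: "inj_on enc (rep ` K \<times> Pow {1..n})"
begin

text \<open>
The copy of \<open>v\<close> seen from the base point \<open>a\<close>: the coset \<open>transporter v\<close> with each \<open>g\<close> replaced by \<open>a \<cdot> g\<close>.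
For \<open>g \<in> \<Gamma>\<^sub>f\<close> the base points \<open>a\<close> and \<open>a \<cdot> g\<close>, if both are good, give the same vertex over \<open>f\<close>; so the
model has about \<open>n / |\<Gamma>\<^sub>f|\<close> vertices over \<open>f\<close>, not \<open>n\<close>.
\<close>

definition sheet :: "nat \<Rightarrow> 'v \<Rightarrow> nat" where
  "sheet a v = enc (rep v, act a ` transporter v)"

lemma act_transporter_range:
  assumes "a \<in> good" "v \<in> K" shows "act a ` transporter v \<subseteq> {1..n}"
  using assms act_range T_tr good_subset by blast

text \<open>
If \<open>a \<cdot> g = b \<cdot> g'\<close>, then \<open>b = a \<cdot> c\<close> with \<open>c = g \<otimes> inv g'\<close>, and by associativity the whole copy of
the graph seen from \<open>b\<close> is the copy seen from \<open>a\<close>, moved by \<open>c\<close>. The piece \<open>K\<close> need not be invariant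
under \<open>c\<close>; this is why transporters are defined for all vertices.
\<close>

lemma base_change:
  assumes a: "a \<in> good" and b: "b \<in> good" and v: "v \<in> K" "v' \<in> K" "rep v = rep v'"
    and g: "g \<in> transporter v" "g' \<in> transporter v'" and eq: "act a g = act b g'"
  obtains c where "c \<in> carrier \<Gamma>" "\<phi> c v' = v"
    "\<And>w. w \<in> K \<Longrightarrow> rep (\<phi> c w) = rep w \<and> act b ` transporter w = act a ` transporter (\<phi> c w)"
proof -
  have gc: "g \<in> carrier \<Gamma>" "g' \<in> carrier \<Gamma>" using g transporter_carrier by auto
  have vV: "v \<in> V" "v' \<in> V" using v K by auto
  define c where "c = g \<otimes> inv g'"
  have c: "c \<in> carrier \<Gamma>" using gc by (simp add: c_def)
  have "b = act b (g' \<otimes> inv g')" using good_one[OF b] gc by simp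
  also have "\<dots> = act (act b g') (inv g')"
    using good_mult[OF b, of g' "inv g'"] T_tr[OF v(2) g(2)] T_inv[OF v(2) g(2)] T_one gc by simp
  also have "\<dots> = act (act a g) (inv g')" using eq by simp
  also have "\<dots> = act a c"
    unfolding c_def
    using good_mult[OF a, of g "inv g'"] T_tr[OF v(1) g(1)] T_inv[OF v(2) g(2)]
      T_quot[OF v(1) g(1) v(2) g(2)] by simp
  finally have bc: "b = act a c" .
  show thesis
  proof (rule that[of c])
    have f: "rep v' \<in> V" using rep_in_domain[OF vV(2)] domain_in_verts by auto
    have "v' = \<phi> g' (rep v')" using g(2) by (auto simp: transporter_def)
    then have "\<phi> (inv g') v' = rep v'"
      using act_mult[of "inv g'" g' "rep v'"] gc f act_one[OF f] by simp
    then have "\<phi> c v' = \<phi> g (rep v')"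
      unfolding c_def using act_mult[of g "inv g'" v'] gc vV by simp
    then show "\<phi> c v' = v" using g(1) v(3) by (simp add: transporter_def)
    fix w assume w: "w \<in> K"
    have "act b t = act a (c \<otimes> t)" if t: "t \<in> transporter w" for t
      unfolding bc using good_mult[OF a, of c t] T_quot[OF v(1) g(1) v(2) g(2)]
        T_tr[OF w t] T_quot_mult[OF v(1) g(1) v(2) g(2) w t] by (simp add: c_def)
    then have "act b ` transporter w = act a ` (\<lambda>t. c \<otimes> t) ` transporter w"
      by (simp add: image_image)
    then show "rep (\<phi> c w) = rep w \<and> act b ` transporter w = act a ` transporter (\<phi> c w)"
      using transporter_act[of w c] rep_act[of w c] c w K by auto
  qed (rule c)
qed

lemma sheet_eq_iff:
  assumes "a \<in> good" "b \<in> good" "v \<in> K" "w \<in> K"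
  shows "sheet a v = sheet b w \<longleftrightarrow> rep v = rep w \<and> act a ` transporter v = act b ` transporter w"
  unfolding sheet_def
  using act_transporter_range[OF assms(1,3)] act_transporter_range[OF assms(2,4)] assms(3,4)
  by (subst inj_on_eq_iff[OF enc_inj]) auto

lemma sheet_change:
  assumes a: "a \<in> good" and b: "b \<in> good" and v: "v \<in> K" "v' \<in> K" and eq: "sheet a v = sheet b v'"
  obtains c where "c \<in> carrier \<Gamma>" "\<phi> c v' = v" "\<And>w. w \<in> K \<Longrightarrow> sheet b w = sheet a (\<phi> c w)"
proof -
  have r: "rep v = rep v'" and im: "act a ` transporter v = act b ` transporter v'"
    using sheet_eq_iff[OF a b v] eq by auto
  obtain g where g: "g \<in> transporter v" using transporter_nonempty[of v] v K by auto
  then have "act a g \<in> act b ` transporter v'" using im by blast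
  then obtain g' where "g' \<in> transporter v'" "act a g = act b g'" by blast
  from base_change[OF a b v r g this] show thesis
    using that unfolding sheet_def by metis
qed

lemma inj_on_sheet: "a \<in> good \<Longrightarrow> inj_on (sheet a) K"
proof (rule inj_onI)
  fix v w assume a: "a \<in> good" and vw: "v \<in> K" "w \<in> K" "sheet a v = sheet a w"
  have r: "rep v = rep w" and "act a ` transporter v = act a ` transporter w"
    using sheet_eq_iff[OF a a vw(1,2)] vw(3) by auto
  moreover have "transporter v \<subseteq> T" "transporter w \<subseteq> T" using T_tr vw by auto
  ultimately have eq: "transporter v = transporter w"
    using inj_on_image_eq_iff[OF good_inj[OF a]] by blast
  obtain g where g: "g \<in> transporter v" using transporter_nonempty[of v] vw K by auto
  have "v = \<phi> g (rep v)" using g by (simp add: transporter_def)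
  also have "\<dots> = \<phi> g (rep w)" by (rule arg_cong[OF r])
  also have "\<dots> = w"
  proof -
    have "g \<in> transporter w" using g unfolding eq .
    then show ?thesis by (simp add: transporter_def)
  qed
  finally show "v = w" .
qed

definition model :: "nat pair_pre_digraph" where
  "model = \<lparr>pverts = {sheet a v | a v. a \<in> good \<and> v \<in> K},
    parcs = {(sheet a v, sheet a w) | a v w. a \<in> good \<and> v \<in> K \<and> w \<in> K \<and> (v, w) \<in> E}\<rparr>"

text \<open>
An arc at \<open>sheet a v\<close> may come from the copy seen from another base point \<open>b\<close>. After the change of base
point it is the image under \<open>sheet a\<close> of an arc of \<open>G\<close> at \<open>v\<close>, because \<open>\<Gamma>\<close> acts by automorphisms.
\<close>

lemma model_nbrs_subset:
  assumes a: "a \<in> good" and v: "v \<in> K"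
  shows "parcs model `` {sheet a v} \<subseteq> sheet a ` (E `` {v})"
proof
  fix y assume "y \<in> parcs model `` {sheet a v}"
  then obtain b v' w' where b: "b \<in> good" "v' \<in> K" "w' \<in> K" "(v', w') \<in> E"
    and eq: "sheet a v = sheet b v'" "y = sheet b w'"
    by (auto simp: model_def)
  obtain c where c: "c \<in> carrier \<Gamma>" "\<phi> c v' = v" "sheet b w' = sheet a (\<phi> c w')"
    using sheet_change[OF a b(1) v b(2) eq(1)] b(3) by metis
  have "(v, \<phi> c w') \<in> E" using act_arc[OF c(1) b(4)] c(2) by simp
  then show "y \<in> sheet a ` (E `` {v})" using eq(2) c(3) by auto
qed

text \<open>
All neighbours of the ball of radius \<open>R\<close> lie in \<open>K\<close>, so every arc of \<open>G\<close> there has been copied; no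
others occur by the previous lemma.
\<close>

lemma model_local_iso:
  assumes a: "a \<in> good" and sub: "rel_ball E (Suc R) v \<subseteq> K"
  shows "local_iso R E v (parcs model) (sheet a v) (sheet a)"
  unfolding local_iso_def
proof (intro conjI ballI)
  show "inj_on (sheet a) (rel_ball E (Suc R) v)"
    using inj_on_sheet[OF a] sub by (rule inj_on_subset)
  fix u assume u: "u \<in> rel_ball E R v"
  have uK: "u \<in> K" using u sub rel_ball_mono[of R "Suc R" E v] by auto
  have "E `` {u} \<subseteq> K" using rel_ball_step[OF u] sub by auto
  then have "sheet a ` (E `` {u}) \<subseteq> parcs model `` {sheet a u}"
    using a uK unfolding model_def by auto
  then show "parcs model `` {sheet a u} = sheet a ` (E `` {u})"
    using model_nbrs_subset[OF a uK] by auto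
qed simp

lemma finite_graph_model: "good \<noteq> {} \<Longrightarrow> K \<noteq> {} \<Longrightarrow> finite_graph model"
proof -
  assume ne: "good \<noteq> {}" "K \<noteq> {}"
  have "pverts model = (\<lambda>(a, v). sheet a v) ` (good \<times> K)" by (auto simp: model_def)
  moreover have "finite good" using good_subset finite_subset by blast
  ultimately have "finite (pverts model)" "pverts model \<noteq> {}" using K ne by auto
  moreover have "pair_bidirected_digraph model"
    unfolding pair_bidirected_digraph_iff
  proof (intro conjI allI)
    show "parcs model \<subseteq> pverts model \<times> pverts model" by (auto simp: model_def)
    show "sym (parcs model)"
      using arcs_sym by (auto simp: model_def intro!: symI dest: symD)
    show "(x, x) \<notin> parcs model" for x
    proof
      assume "(x, x) \<in> parcs model"
      then obtain a v w where avw: "a \<in> good" "v \<in> K" "w \<in> K" "(v, w) \<in> E" "sheet a v = sheet a w"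
        by (auto simp: model_def)
      then have "v = w" using inj_on_sheet by (metis inj_onD)
      then show False using avw no_loops by simp
    qed
  qed
  ultimately show ?thesis by (simp add: finite_graph_def)
qed

lemma degree_bounded_model: "degree_bounded D model"
  unfolding degree_bounded_iff
proof
  fix x assume "x \<in> pverts model"
  then obtain a v where av: "a \<in> good" "v \<in> K" "x = sheet a v" by (auto simp: model_def)
  then have v: "v \<in> V" using K by auto
  have "finite (sheet a ` (E `` {v}))" "card (sheet a ` (E `` {v})) \<le> D"
    using finite_nbrs[OF v] degree_le[OF v] card_image_le[OF finite_nbrs[OF v], of "sheet a"] by auto
  then show "finite (parcs model `` {x}) \<and> card (parcs model `` {x}) \<le> D"
    using model_nbrs_subset[OF av(1,2)] av(3) by (meson card_mono finite_subset order_trans)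
qed

text \<open>
The subsets of \<open>{1..n}\<close> that encode the vertices over \<open>f\<close>. The parameter \<open>L\<close> restricts to the copies of
vertices in \<open>L\<close>, which is needed to single out the vertices with a large ball inside the model.
\<close>

definition fibre :: "'v set \<Rightarrow> 'v \<Rightarrow> nat set set" where
  "fibre L f = {act a ` transporter v | a v. a \<in> good \<and> v \<in> L \<and> rep v = f}"

text \<open>
By freeness at good points each block has as many elements as the stabilizer, and by the change of base
point two blocks that meet are equal.
\<close>

lemma card_Union_fibre:
  assumes "L \<subseteq> K" "f \<in> F"
  shows "finite (fibre L f)" "\<Union> (fibre L f) \<subseteq> {1..n}"
    "card (fibre L f) * card (stabilizer \<Gamma> \<phi> f) = card (\<Union> (fibre L f))"
proof -
  have sub: "fibre L f \<subseteq> Pow {1..n}"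
    using act_transporter_range assms(1) unfolding fibre_def by blast
  then show fin: "finite (fibre L f)" and U: "\<Union> (fibre L f) \<subseteq> {1..n}"
    by (auto intro: finite_subset)
  have c: "card X = card (stabilizer \<Gamma> \<phi> f)" if X: "X \<in> fibre L f" for X
  proof -
    obtain a v where av: "a \<in> good" "v \<in> L" "rep v = f" "X = act a ` transporter v"
      using X by (auto simp: fibre_def)
    have "transporter v \<subseteq> T" "v \<in> V" using T_tr av(2) assms(1) K by auto
    then show ?thesis
      using card_transporter[of v] av good_inj[OF av(1)] by (simp add: card_image inj_on_subset)
  qed
  have d: "X \<inter> Y = {}" if XY: "X \<in> fibre L f" "Y \<in> fibre L f" "X \<noteq> Y" for X Y
  proof (rule ccontr)
    assume "X \<inter> Y \<noteq> {}"
    obtain a v where av: "a \<in> good" "v \<in> K" "rep v = f" "X = act a ` transporter v"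
      using XY(1) assms(1) by (auto simp: fibre_def)
    obtain b w where bw: "b \<in> good" "w \<in> K" "rep w = f" "Y = act b ` transporter w"
      using XY(2) assms(1) by (auto simp: fibre_def)
    obtain g h where gh: "g \<in> transporter v" "h \<in> transporter w" "act a g = act b h"
      using \<open>X \<inter> Y \<noteq> {}\<close> av(4) bw(4) by auto
    have "rep v = rep w" using av bw by simp
    from base_change[OF av(1) bw(1) av(2) bw(2) this gh] have "Y = X"
      using av bw by metis
    then show False using XY by simp
  qed
  have "card (stabilizer \<Gamma> \<phi> f) * card (fibre L f) = card (\<Union> (fibre L f))"
    using fin finite_subset[OF U] c d by (intro card_partition) auto
  then show "card (fibre L f) * card (stabilizer \<Gamma> \<phi> f) = card (\<Union> (fibre L f))"
    by (simp add: mult.commute)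
qed

lemma card_fibre_le:
  assumes "L \<subseteq> K" "f \<in> F"
  shows "real (card (fibre L f)) \<le> real n / real (card (stabilizer \<Gamma> \<phi> f))"
proof -
  have "card (fibre L f) * card (stabilizer \<Gamma> \<phi> f) \<le> card {1..n}"
    unfolding card_Union_fibre(3)[OF assms] by (rule card_mono[OF _ card_Union_fibre(2)[OF assms]]) simp
  then have "real (card (fibre L f)) * real (card (stabilizer \<Gamma> \<phi> f)) \<le> real n"
    by (metis card_atLeastAtMost diff_Suc_1 of_nat_le_iff of_nat_mult)
  then show ?thesis
    using card_stabilizer_pos[of f] assms(2) domain_in_verts by (auto simp: field_simps)
qed

text \<open>
The unit belongs to the transporter of \<open>f\<close>, so each good point \<open>a\<close> lies in the block of \<open>f\<close> seen from \<open>a\<close>.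
\<close>

lemma card_fibre_ge:
  assumes "f \<in> F" "L \<subseteq> K" "f \<in> L"
  shows "real (card good) / real (card (stabilizer \<Gamma> \<phi> f)) \<le> real (card (fibre L f))"
proof -
  have "good \<subseteq> \<Union> (fibre L f)"
  proof
    fix a assume a: "a \<in> good"
    have "\<one> \<in> transporter f"
      using assms(1) domain_in_verts act_one by (auto simp: transporter_def rep_domain)
    then have "a \<in> act a ` transporter f" using good_one[OF a] by force
    moreover have "act a ` transporter f \<in> fibre L f"
      using a assms rep_domain by (auto simp: fibre_def)
    ultimately show "a \<in> \<Union> (fibre L f)" by blast
  qed
  then have "card good \<le> card (fibre L f) * card (stabilizer \<Gamma> \<phi> f)"
    unfolding card_Union_fibre(3)[OF assms(2,1)]
    using card_Union_fibre(2)[OF assms(2,1)] by (intro card_mono) (auto intro: finite_subset)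
  then have "real (card good) \<le> real (card (fibre L f)) * real (card (stabilizer \<Gamma> \<phi> f))"
    by (metis of_nat_le_iff of_nat_mult)
  then show ?thesis
    using card_stabilizer_pos[of f] assms(1) domain_in_verts by (auto simp: field_simps)
qed

end

context periodic_action
begin

lemma exists_partial_sofic_model:
  assumes sofic: "sofic_group \<Gamma>" and K: "finite K" "K \<subseteq> V" and \<epsilon>: "\<epsilon> > 0"
  obtains T n act good enc where "partial_sofic_model \<Gamma> \<phi> V E F D K T n act good enc"
    "n \<ge> 1" "real (card good) \<ge> (1 - \<epsilon>) * real n"
proof -
  define C where "C = (\<Union>v\<in>K. transporter v)"
  define T where "T = {\<one>} \<union> C \<union> (\<lambda>g. inv g) ` C \<union> (\<lambda>(g, h). g \<otimes> inv h) ` (C \<times> C) \<union>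
    (\<lambda>(g, h, k). g \<otimes> inv h \<otimes> k) ` (C \<times> C \<times> C)"
  have C: "finite C" "C \<subseteq> carrier \<Gamma>"
    unfolding C_def using K card_transporter(1) transporter_carrier by auto
  have T: "finite T" "T \<subseteq> carrier \<Gamma>"
    unfolding T_def using C by auto
  obtain n :: nat and act :: "nat \<Rightarrow> 'g \<Rightarrow> nat" and good :: "nat set"
    where n: "n \<ge> 1" and good: "good \<subseteq> {1..n}" "real (card good) \<ge> (1 - \<epsilon>) * real n"
      and act: "\<And>a s. a \<in> {1..n} \<Longrightarrow> s \<in> T \<Longrightarrow> act a s \<in> {1..n}"
        "\<And>a s t. a \<in> good \<Longrightarrow> s \<in> T \<Longrightarrow> t \<in> T \<Longrightarrow> s \<otimes> t \<in> T \<Longrightarrow> act (act a s) t = act a (s \<otimes> t)"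
        "\<And>a. a \<in> good \<Longrightarrow> act a \<one> = a" "\<And>a. a \<in> good \<Longrightarrow> inj_on (act a) T"
    by (rule sofic_right_action[OF sofic T \<epsilon>]) (rule that; assumption)
  have "finite (rep ` K \<times> Pow {1..n})" using K by simp
  then obtain enc :: "'v \<times> nat set \<Rightarrow> nat" where enc: "inj_on enc (rep ` K \<times> Pow {1..n})"
    using finite_imp_inj_to_nat_seg by metis
  have "partial_sofic_model \<Gamma> \<phi> V E F D K T n act good enc"
  proof (intro partial_sofic_model.intro partial_sofic_model_axioms.intro)
    show "periodic_action \<Gamma> \<phi> V E F D" ..
    have in_C: "g \<in> C" if "v \<in> K" "g \<in> transporter v" for v g using that by (auto simp: C_def)
    show "g \<in> T" "inv g \<in> T" if "v \<in> K" "g \<in> transporter v" for v g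
      using in_C[OF that] by (auto simp: T_def)
    show "g \<otimes> inv h \<in> T" if "v \<in> K" "g \<in> transporter v" "w \<in> K" "h \<in> transporter w" for v w g h
      using in_C[OF that(1,2)] in_C[OF that(3,4)] by (force simp: T_def)
    show "g \<otimes> inv h \<otimes> k \<in> T"
      if "v \<in> K" "g \<in> transporter v" "w \<in> K" "h \<in> transporter w" "u \<in> K" "k \<in> transporter u"
      for u v w g h k
      using in_C[OF that(1,2)] in_C[OF that(3,4)] in_C[OF that(5,6)] by (force simp: T_def)
  qed (use K T(1) good(1) act enc in \<open>simp_all add: T_def\<close>)
  then show thesis using that n good(2) by blast
qed

definition weight :: "'v \<Rightarrow> real" where
  "weight f = 1 / real (card (stabilizer \<Gamma> \<phi> f))"

definition volume :: real where
  "volume = (\<Sum>\<^sub>\<infinity>f\<in>F. weight f)"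

lemma weight_summable: "weight summable_on F"
  using domain_summable by (simp add: weight_def[abs_def])

lemma weight_nonneg: "weight f \<ge> 0"
  by (simp add: weight_def)

lemma weight_pos: "f \<in> F \<Longrightarrow> weight f > 0"
  using card_stabilizer_pos[of f] domain_in_verts by (auto simp: weight_def)

lemma sum_weight_le_volume: "finite L \<Longrightarrow> L \<subseteq> F \<Longrightarrow> sum weight L \<le> volume"
  unfolding volume_def by (rule finite_sum_le_infsum[OF weight_summable]) (auto simp: weight_nonneg)

lemma volume_pos: "F \<noteq> {} \<Longrightarrow> volume > 0"
proof -
  assume "F \<noteq> {}"
  then obtain f where f: "f \<in> F" by blast
  then show ?thesis using sum_weight_le_volume[of "{f}"] weight_pos[OF f] by simp
qed

lemma bounded_weight_summable:
  assumes "\<And>f. f \<in> F \<Longrightarrow> \<bar>\<psi> f\<bar> \<le> M"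
  shows "(\<lambda>f. \<psi> f * weight f) summable_on F"
proof (rule abs_summable_summable, rule summable_on_comparison_test)
  show "(\<lambda>f. M * weight f) summable_on F"
    using weight_summable by (rule summable_on_cmult_right)
  show "norm (\<psi> f * weight f) \<le> M * weight f" if "f \<in> F" for f
    using assms[OF that] weight_nonneg[of f] by (simp add: abs_mult mult_right_mono)
qed simp

lemma infsum_tail_le:
  assumes \<psi>: "\<And>f. f \<in> F \<Longrightarrow> \<bar>\<psi> f\<bar> \<le> M" and L: "finite L" "L \<subseteq> F"
  shows "\<bar>(\<Sum>\<^sub>\<infinity>f\<in>F. \<psi> f * weight f) - (\<Sum>f\<in>L. \<psi> f * weight f)\<bar> \<le> M * (volume - sum weight L)"
proof -
  have s: "(\<lambda>f. \<psi> f * weight f) summable_on F" by (rule bounded_weight_summable[OF \<psi>])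
  have s': "(\<lambda>f. \<psi> f * weight f) summable_on (F - L)" "weight summable_on (F - L)"
    using s weight_summable by (auto intro: summable_on_subset_banach)
  have "(\<Sum>\<^sub>\<infinity>f\<in>F. \<psi> f * weight f) - (\<Sum>f\<in>L. \<psi> f * weight f) = (\<Sum>\<^sub>\<infinity>f\<in>F - L. \<psi> f * weight f)"
    using infsum_Diff[OF s summable_on_finite[OF L(1)] L(2)] L(1) by simp
  moreover have "volume - sum weight L = (\<Sum>\<^sub>\<infinity>f\<in>F - L. weight f)"
    unfolding volume_def using infsum_Diff[OF weight_summable summable_on_finite[OF L(1)] L(2)] L(1) by simp
  moreover have "norm (\<Sum>\<^sub>\<infinity>f\<in>F - L. \<psi> f * weight f) \<le> (\<Sum>\<^sub>\<infinity>f\<in>F - L. M * weight f)"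
  proof (rule norm_infsum_le)
    show "((\<lambda>f. \<psi> f * weight f) has_sum (\<Sum>\<^sub>\<infinity>f\<in>F - L. \<psi> f * weight f)) (F - L)"
      using s'(1) by (rule has_sum_infsum)
    show "((\<lambda>f. M * weight f) has_sum (\<Sum>\<^sub>\<infinity>f\<in>F - L. M * weight f)) (F - L)"
      using s'(2) by (intro has_sum_infsum summable_on_cmult_right)
    show "norm (\<psi> f * weight f) \<le> M * weight f" if "f \<in> F - L" for f
      using \<psi>[of f] that weight_nonneg[of f] by (simp add: abs_mult mult_right_mono)
  qed
  ultimately show ?thesis by (simp add: infsum_cmult_right')
qed

lemma finite_domain_approx:
  assumes "\<delta> > 0" "F \<noteq> {}"
  obtains L where "finite L" "L \<subseteq> F" "L \<noteq> {}" "volume - sum weight L \<le> \<delta>"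
proof -
  have "(weight has_sum volume) F"
    unfolding volume_def using weight_summable by (rule has_sum_infsum)
  from has_sum_finite_approximation[OF this assms(1)]
  obtain L0 where L0: "finite L0" "L0 \<subseteq> F" "dist (sum weight L0) volume \<le> \<delta>"
    by blast
  obtain f where f: "f \<in> F" using assms(2) by blast
  have "sum weight L0 \<le> sum weight (insert f L0)"
    using L0(1) by (intro sum_mono2) (auto simp: weight_nonneg)
  then show thesis
    using that[of "insert f L0"] L0 f by (auto simp: dist_real_def)
qed

text \<open>
The finite models in the form in which they are used. The last clause says that the distribution of labels is
close to the weights in total variation; it is stated through bounded test functions because it is
applied to such functions. The number \<open>N\<close> is the size of the sofic approximation.
\<close>

theorem finite_models_exist:
  assumes sofic: "sofic_group \<Gamma>" and F: "F \<noteq> {}" and \<epsilon>: "\<epsilon> > 0"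
  obtains H :: "nat pair_pre_digraph" and W :: "nat set" and \<tau> :: "nat \<Rightarrow> 'v" and N :: real
  where "finite_graph H" "degree_bounded D H" "N > 0" "W \<subseteq> pverts H"
    "\<And>x. x \<in> W \<Longrightarrow> \<tau> x \<in> F" "\<And>x. x \<in> W \<Longrightarrow> \<exists>\<pi>. local_iso R E (\<tau> x) (parcs H) x \<pi>"
    "real (card (pverts H - W)) \<le> \<epsilon> * N"
    "\<And>\<psi> M. (\<And>f. f \<in> F \<Longrightarrow> \<bar>\<psi> f\<bar> \<le> M) \<Longrightarrow>
      \<bar>(\<Sum>x\<in>W. \<psi> (\<tau> x)) / N - (\<Sum>\<^sub>\<infinity>f\<in>F. \<psi> f * weight f)\<bar> \<le> M * \<epsilon>"
proof -
  \<comment> \<open>\<open>\<delta>\<close> bounds the weight outside \<open>L\<close>, \<open>\<eta>\<close> the proportion of bad points; \<open>\<eta> < 1\<close> ensures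
    that there is a good point.\<close>
  define \<delta> where "\<delta> = \<epsilon> / 2"
  define \<eta> where "\<eta> = min (1 / 2) (\<epsilon> / (2 * (volume + 1)))"
  have vol: "volume > 0" using volume_pos[OF F] .
  have \<delta>: "\<delta> > 0" and \<eta>: "\<eta> > 0" "\<eta> < 1"
    unfolding \<delta>_def \<eta>_def using \<epsilon> vol by auto
  have "\<eta> * volume \<le> \<epsilon> / (2 * (volume + 1)) * volume"
    unfolding \<eta>_def using vol by (intro mult_right_mono) auto
  also have "\<dots> \<le> \<epsilon> / 2" using vol \<epsilon> by (simp add: field_simps)
  finally have err: "\<eta> * volume + \<delta> \<le> \<epsilon>" by (simp add: \<delta>_def)
  obtain L where L: "finite L" "L \<subseteq> F" "L \<noteq> {}" "volume - sum weight L \<le> \<delta>"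
    using finite_domain_approx[OF \<delta> F] by blast
  define K where "K = (\<Union>f\<in>L. rel_ball E (Suc R) f)"
  have LV: "f \<in> V" if "f \<in> L" for f using that L(2) domain_in_verts by auto
  have "finite (rel_ball E (Suc R) f)" if "f \<in> L" for f
    by (rule finite_rel_ball[OF finite_nbrs arcs_in_verts LV[OF that]])
  moreover have "rel_ball E (Suc R) f \<subseteq> V" if "f \<in> L" for f
    by (rule rel_ball_in_verts[OF arcs_in_verts LV[OF that]])
  moreover have "f \<in> rel_ball E (Suc R) f" for f by (rule rel_ball_center)
  ultimately have K: "finite K" "K \<subseteq> V" "L \<subseteq> K"
    unfolding K_def using L(1) by auto
  obtain T n act good enc where "partial_sofic_model \<Gamma> \<phi> V E F D K T n act good enc"
    and n: "n \<ge> 1" and card_good: "real (card good) \<ge> (1 - \<eta>) * real n"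
    by (rule exists_partial_sofic_model[OF sofic K(1,2) \<eta>(1)]) (rule that; assumption)
  then interpret M: partial_sofic_model \<Gamma> \<phi> V E F D K T n act good enc by simp
  have "good \<noteq> {}" using card_good n \<eta> by (auto simp: mult_le_0_iff)
  have "K \<noteq> {}" using L K by auto
  \<comment> \<open>\<open>P f\<close> encodes all vertices over \<open>f\<close>, \<open>Q f\<close> those whose ball is known to be a ball of \<open>G\<close>.\<close>
  define P where "P = M.fibre K"
  define Q where "Q = M.fibre L"
  have rep_L: "rep v = v" if "v \<in> L" for v using that rep_domain L by auto
  have QP: "Q f \<subseteq> P f" for f unfolding P_def Q_def M.fibre_def using K(3) by blast
  have rK: "rep ` K \<subseteq> F" "L \<subseteq> rep ` K"
    using rep_in_domain K rep_L by (auto intro: rev_image_eqI)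
  have PS: "P f \<subseteq> Pow {1..n}" "finite (P f)" if "f \<in> F" for f
    using M.card_Union_fibre[OF order_refl that] unfolding P_def by blast+
  define WP where "WP = (SIGMA f:rep ` K. P f)"
  define WQ where "WQ = (SIGMA f:L. Q f)"
  define W where "W = enc ` WQ"
  define \<tau> where "\<tau> = (\<lambda>x. fst (inv_into (rep ` K \<times> Pow {1..n}) enc x))"
  have "P f \<subseteq> Pow {1..n}" if "f \<in> rep ` K" for f
    by (rule PS(1)[OF subsetD[OF rK(1) that]])
  then have WP: "WP \<subseteq> rep ` K \<times> Pow {1..n}"
    unfolding WP_def by (rule Sigma_mono[OF order_refl])
  have WQP: "WQ \<subseteq> WP"
    unfolding WP_def WQ_def by (rule Sigma_mono[OF rK(2) QP])
  have verts: "pverts M.model = enc ` WP"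
  proof (intro equalityI subsetI)
    fix x assume "x \<in> pverts M.model"
    then obtain a v where av: "a \<in> good" "v \<in> K" "x = M.sheet a v" by (auto simp: M.model_def)
    then have "(rep v, act a ` transporter v) \<in> WP"
      by (auto simp: WP_def P_def M.fibre_def)
    then show "x \<in> enc ` WP" unfolding av(3) M.sheet_def by (rule imageI)
  next
    fix x assume "x \<in> enc ` WP"
    then obtain f X where "x = enc (f, X)" "X \<in> P f" by (auto simp: WP_def)
    then show "x \<in> pverts M.model"
      by (auto simp: P_def M.fibre_def M.model_def M.sheet_def)
  qed
  have inj: "inj_on enc WP" "inj_on enc WQ"
    using inj_on_subset[OF M.enc_inj WP] inj_on_subset[OF M.enc_inj order_trans[OF WQP WP]]
    by simp_all
  have \<tau>: "\<tau> (enc p) = fst p" if "p \<in> WQ" for p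
    unfolding \<tau>_def 
    using inv_into_f_f[OF M.enc_inj subsetD[OF order_trans[OF WQP WP] that]] by simp
  have finP: "finite WP"
    unfolding WP_def by (rule finite_SigmaI[OF finite_imageI[OF K(1)] PS(2)[OF subsetD[OF rK(1)]]])
  have finQ: "finite WQ" by (rule finite_subset[OF WQP finP])
  have sumQ: "(\<Sum>x\<in>W. \<psi> (\<tau> x)) = (\<Sum>f\<in>L. real (card (Q f)) * \<psi> f)" for \<psi> :: "'v \<Rightarrow> real"
  proof -
    have "(\<Sum>x\<in>W. \<psi> (\<tau> x)) = (\<Sum>p\<in>WQ. \<psi> (fst p))"
      unfolding W_def using \<tau> by (simp add: sum.reindex[OF inj(2)])
    also have "\<dots> = (\<Sum>f\<in>L. \<Sum>X\<in>Q f. \<psi> f)"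
    proof -
      have "\<forall>f\<in>L. finite (Q f)" using PS(2) QP L(2) by (meson finite_subset subsetD)
      from sum.Sigma[OF L(1) this, of "\<lambda>f X. \<psi> f"] show ?thesis
        by (simp add: WQ_def split_beta)
    qed
    finally show ?thesis by simp
  qed
  have Qle: "real (card (Q f)) \<le> real n * weight f" if "f \<in> L" for f
    using M.card_fibre_le[OF K(3), of f] that L(2) unfolding Q_def weight_def by auto
  have Qge: "(1 - \<eta>) * real n * weight f \<le> real (card (Q f))" if f: "f \<in> L" for f
  proof -
    have "(1 - \<eta>) * real n * weight f \<le> real (card good) * weight f"
      using card_good weight_nonneg by (rule mult_right_mono)
    also have "\<dots> \<le> real (card (Q f))"
      using M.card_fibre_ge[of f L] f L K unfolding Q_def weight_def by auto
    finally show ?thesis .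
  qed
  show thesis
  proof (rule that[of M.model "real n" W \<tau>])
    show "finite_graph M.model" by (rule M.finite_graph_model) fact+
    show "degree_bounded D M.model" by (rule M.degree_bounded_model)
    show "real n > 0" using n by simp
    show WH: "W \<subseteq> pverts M.model" unfolding W_def verts by (rule image_mono[OF WQP])
    have W_cases: "\<exists>a f. a \<in> good \<and> f \<in> L \<and> x = M.sheet a f \<and> \<tau> x = f" if "x \<in> W" for x
    proof -
      obtain f X where fX: "f \<in> L" "X \<in> Q f" "x = enc (f, X)" "(f, X) \<in> WQ"
        using \<open>x \<in> W\<close> by (auto simp: W_def WQ_def)
      then obtain a v where "a \<in> good" "v \<in> L" "rep v = f" "X = act a ` transporter v"
        by (auto simp: Q_def M.fibre_def)
      then show ?thesis
        using fX \<tau>[OF fX(4)] rep_L by (auto simp: M.sheet_def)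
    qed
    show "\<tau> x \<in> F" if "x \<in> W" for x using W_cases[OF that] L by auto
    show "\<exists>\<pi>. local_iso R E (\<tau> x) (parcs M.model) x \<pi>" if "x \<in> W" for x
    proof -
      obtain a f where af: "a \<in> good" "f \<in> L" "x = M.sheet a f" "\<tau> x = f"
        using W_cases[OF \<open>x \<in> W\<close>] by blast
      have "rel_ball E (Suc R) f \<subseteq> K" using af(2) by (auto simp: K_def)
      then show ?thesis using M.model_local_iso[OF af(1)] af(3,4) by auto
    qed
    show "real (card (pverts M.model - W)) \<le> \<epsilon> * real n"
    proof -
      have "card (pverts M.model - W) = card WP - card WQ"
        using WH finP finQ inj unfolding W_def verts by (simp add: card_Diff_subset card_image)
      moreover have "card WQ \<le> card WP" using card_mono[OF finP WQP] .
      ultimately have "real (card (pverts M.model - W)) = real (card WP) - real (card WQ)"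
        by simp
      moreover have "real (card WP) \<le> real n * volume"
      proof -
        have "card WP = (\<Sum>f\<in>rep ` K. card (P f))"
          unfolding WP_def
          by (rule card_SigmaI[OF finite_imageI[OF K(1)]])
            (rule ballI, rule PS(2)[OF subsetD[OF rK(1)]])
        then have "real (card WP) = (\<Sum>f\<in>rep ` K. real (card (P f)))" by simp
        also have "\<dots> \<le> (\<Sum>f\<in>rep ` K. real n * weight f)"
          using M.card_fibre_le[OF order_refl] rK unfolding P_def weight_def
          by (intro sum_mono) auto
        also have "\<dots> \<le> real n * volume"
          using sum_weight_le_volume[of "rep ` K"] K(1) rK
          by (simp add: sum_distrib_left[symmetric] mult_left_mono)
        finally show ?thesis .
      qed
      moreover have "real (card WQ) \<ge> (1 - \<eta>) * real n * (volume - \<delta>)"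
      proof -
        have "(1 - \<eta>) * real n * (volume - \<delta>) \<le> (1 - \<eta>) * real n * sum weight L"
          using L(4) \<eta> by (intro mult_left_mono) auto
        also have "\<dots> = (\<Sum>f\<in>L. (1 - \<eta>) * real n * weight f)" by (simp add: sum_distrib_left)
        also have "\<dots> \<le> (\<Sum>f\<in>L. real (card (Q f)))" using Qge by (rule sum_mono)
        also have "\<dots> = real (card WQ)"
          using sumQ[of "\<lambda>_. 1"] inj(2) by (simp add: W_def card_image)
        finally show ?thesis .
      qed
      ultimately have "real (card (pverts M.model - W)) \<le>
          real n * volume - (1 - \<eta>) * real n * (volume - \<delta>)" by linarith
      also have "\<dots> = (\<eta> * volume + \<delta> - \<eta> * \<delta>) * real n" by (simp add: algebra_simps)
      also have "\<dots> \<le> \<epsilon> * real n"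
        using err \<eta>(1) \<delta> mult_pos_pos[OF \<eta>(1) \<delta>] by (intro mult_right_mono) linarith+
      finally show ?thesis .
    qed
    fix \<psi> :: "'v \<Rightarrow> real" and M
    assume \<psi>: "\<And>f. f \<in> F \<Longrightarrow> \<bar>\<psi> f\<bar> \<le> M"
    have M: "M \<ge> 0" using F \<psi> by (meson abs_ge_zero all_not_in_conv order_trans)
    have "\<bar>(\<Sum>x\<in>W. \<psi> (\<tau> x)) / real n - (\<Sum>f\<in>L. \<psi> f * weight f)\<bar>
        = \<bar>\<Sum>f\<in>L. \<psi> f * (real (card (Q f)) / real n - weight f)\<bar>"
      unfolding sumQ by (simp add: sum_divide_distrib sum_subtractf[symmetric] algebra_simps)
    also have "\<dots> \<le> (\<Sum>f\<in>L. M * (\<eta> * weight f))"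
    proof (rule order_trans[OF sum_abs sum_mono])
      fix f assume f: "f \<in> L"
      have "real (card (Q f)) / real n \<le> weight f" "(1 - \<eta>) * weight f \<le> real (card (Q f)) / real n"
        using Qle[OF f] Qge[OF f] n by (simp_all add: field_simps)
      then have "\<bar>real (card (Q f)) / real n - weight f\<bar> \<le> \<eta> * weight f"
        by (simp add: algebra_simps abs_le_iff)
      then show "\<bar>\<psi> f * (real (card (Q f)) / real n - weight f)\<bar> \<le> M * (\<eta> * weight f)"
        unfolding abs_mult using \<psi>[of f] f L(2) M by (intro mult_mono) auto
    qed
    also have "\<dots> = M * (\<eta> * sum weight L)" by (simp add: sum_distrib_left)
    also have "\<dots> \<le> M * (\<eta> * volume)"
      using sum_weight_le_volume[OF L(1,2)] M \<eta>(1) by (intro mult_left_mono) auto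
    finally have "\<bar>(\<Sum>x\<in>W. \<psi> (\<tau> x)) / real n - (\<Sum>f\<in>L. \<psi> f * weight f)\<bar> \<le> M * (\<eta> * volume)" .
    moreover have "\<bar>(\<Sum>\<^sub>\<infinity>f\<in>F. \<psi> f * weight f) - (\<Sum>f\<in>L. \<psi> f * weight f)\<bar> \<le> M * \<delta>"
      using infsum_tail_le[of \<psi> M, OF \<psi> L(1,2)] mult_left_mono[OF L(4) M] by linarith
    ultimately have "\<bar>(\<Sum>x\<in>W. \<psi> (\<tau> x)) / real n - (\<Sum>\<^sub>\<infinity>f\<in>F. \<psi> f * weight f)\<bar>
        \<le> M * (\<eta> * volume) + M * \<delta>" by linarith
    also have "\<dots> \<le> M * \<epsilon>" using mult_left_mono[OF err M] by (simp add: algebra_simps)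
    finally show "\<bar>(\<Sum>x\<in>W. \<psi> (\<tau> x)) / real n - (\<Sum>\<^sub>\<infinity>f\<in>F. \<psi> f * weight f)\<bar> \<le> M * \<epsilon>" .
  qed
qed

end

section \<open>Convergence of averages\<close>

context periodic_action
begin

text \<open>
A quantity \<open>h\<close> of rooted finite graphs is local if it agrees with a function \<open>\<psi>\<close> of the vertices of \<open>G\<close>
across local isomorphisms of some radius \<open>r\<close>. The same sequence serves all bounded local quantities,
as its \<open>k\<close>-th member has radius \<open>k\<close> and error \<open>1 / (k + 1)\<close>. Applying the approximation also to the constant \<open>1\<close>
shows that the number of vertices divided by \<open>N\<close> tends to the covolume, and the average is a quotient
of two convergent sequences.
\<close>

theorem convergent_models_exist:
  assumes sofic: "sofic_group \<Gamma>" and F: "F \<noteq> {}"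
  obtains Gs :: "nat \<Rightarrow> nat pair_pre_digraph"
  where "\<And>n. finite_graph (Gs n)" "\<And>n. degree_bounded D (Gs n)"
    "\<And>h \<psi> M r.
      (\<And>H x. finite_graph H \<Longrightarrow> degree_bounded D H \<Longrightarrow> x \<in> pverts H \<Longrightarrow> \<bar>h H x\<bar> \<le> M) \<Longrightarrow>
      (\<And>f. f \<in> F \<Longrightarrow> \<bar>\<psi> f\<bar> \<le> M) \<Longrightarrow>
      (\<And>H x f \<pi>. finite_graph H \<Longrightarrow> degree_bounded D H \<Longrightarrow> x \<in> pverts H \<Longrightarrow> f \<in> F \<Longrightarrow>
        local_iso r E f (parcs H) x \<pi> \<Longrightarrow> h H x = \<psi> f) \<Longrightarrow>
      (\<lambda>n. (\<Sum>x\<in>pverts (Gs n). h (Gs n) x) / real (card (pverts (Gs n))))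
        \<longlonglongrightarrow> (\<Sum>\<^sub>\<infinity>f\<in>F. \<psi> f * weight f) / volume"
proof -
  define P where "P = (\<lambda>k (H :: nat pair_pre_digraph, W, \<tau>, N). finite_graph H \<and> degree_bounded D H \<and>
    N > 0 \<and> W \<subseteq> pverts H \<and> (\<forall>x\<in>W. \<tau> x \<in> F) \<and>
    (\<forall>x\<in>W. \<exists>\<pi>. local_iso k E (\<tau> x) (parcs H) x \<pi>) \<and>
    real (card (pverts H - W)) \<le> 1 / real (Suc k) * N \<and>
    (\<forall>\<psi> M. (\<forall>f\<in>F. \<bar>\<psi> f\<bar> \<le> M) \<longrightarrow>
      \<bar>(\<Sum>x\<in>W. \<psi> (\<tau> x)) / N - (\<Sum>\<^sub>\<infinity>f\<in>F. \<psi> f * weight f)\<bar> \<le> M * (1 / real (Suc k))))"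
  have "\<exists>t. P k t" for k
  proof -
    have pos: "1 / real (Suc k) > 0" by simp
    show ?thesis
    proof (rule finite_models_exist[OF sofic F pos, of k])
      fix H :: "nat pair_pre_digraph" and W \<tau> N
      assume 1: "finite_graph H" "degree_bounded D H" "N > 0" "W \<subseteq> pverts H"
        and 2: "\<And>x. x \<in> W \<Longrightarrow> \<tau> x \<in> F" "\<And>x. x \<in> W \<Longrightarrow> \<exists>\<pi>. local_iso k E (\<tau> x) (parcs H) x \<pi>"
        and 3: "real (card (pverts H - W)) \<le> 1 / real (Suc k) * N"
        and 4: "\<And>\<psi> M. (\<And>f. f \<in> F \<Longrightarrow> \<bar>\<psi> f\<bar> \<le> M) \<Longrightarrow>
          \<bar>(\<Sum>x\<in>W. \<psi> (\<tau> x)) / N - (\<Sum>\<^sub>\<infinity>f\<in>F. \<psi> f * weight f)\<bar> \<le> M * (1 / real (Suc k))"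
      have "P k (H, W, \<tau>, N)"
        unfolding P_def split by (intro conjI allI impI ballI 1 2 3 4) auto
      then show ?thesis ..
    qed
  qed
  then obtain t where t: "\<And>k. P k (t k)" by metis
  define Gs where "Gs = (\<lambda>k. fst (t k))"
  define W where "W = (\<lambda>k. fst (snd (t k)))"
  define \<tau> where "\<tau> = (\<lambda>k. fst (snd (snd (t k))))"
  define N where "N = (\<lambda>k. snd (snd (snd (t k))))"
  have P: "P k (Gs k, W k, \<tau> k, N k)" for k
    using t[of k] by (simp add: Gs_def W_def \<tau>_def N_def)
  have fin: "finite_graph (Gs k)" and deg: "degree_bounded D (Gs k)" and N: "N k > 0"
    and W: "W k \<subseteq> pverts (Gs k)" and \<tau>F: "x \<in> W k \<Longrightarrow> \<tau> k x \<in> F"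
    and iso: "x \<in> W k \<Longrightarrow> \<exists>\<pi>. local_iso k E (\<tau> k x) (parcs (Gs k)) x \<pi>"
    and rest: "real (card (pverts (Gs k) - W k)) \<le> 1 / real (Suc k) * N k"
    for k x using P[of k] unfolding P_def by simp_all
  have stat: "\<bar>(\<Sum>x\<in>W k. \<psi> (\<tau> k x)) / N k - (\<Sum>\<^sub>\<infinity>f\<in>F. \<psi> f * weight f)\<bar> \<le> M * (1 / real (Suc k))"
    if "\<And>f. f \<in> F \<Longrightarrow> \<bar>\<psi> f\<bar> \<le> M" for k \<psi> M
    using P[of k] that unfolding P_def by simp
  have finV: "finite (pverts (Gs k))" "pverts (Gs k) \<noteq> {}" for k
    using fin[of k] by (simp_all add: finite_graph_def)
  have lim: "(\<lambda>k. (\<Sum>x\<in>pverts (Gs k). h (Gs k) x) / N k) \<longlonglongrightarrow> (\<Sum>\<^sub>\<infinity>f\<in>F. \<psi> f * weight f)"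
    if h: "\<And>H x. finite_graph H \<Longrightarrow> degree_bounded D H \<Longrightarrow> x \<in> pverts H \<Longrightarrow> \<bar>h H x\<bar> \<le> M"
      and \<psi>: "\<And>f. f \<in> F \<Longrightarrow> \<bar>\<psi> f\<bar> \<le> M"
      and h\<psi>: "\<And>H x f \<pi>. finite_graph H \<Longrightarrow> degree_bounded D H \<Longrightarrow> x \<in> pverts H \<Longrightarrow> f \<in> F \<Longrightarrow>
        local_iso r E f (parcs H) x \<pi> \<Longrightarrow> h H x = \<psi> f" for h \<psi> M r
  proof (rule LIM_zero_cancel, rule Lim_null_comparison[where g = "\<lambda>k. 2 * M * (1 / real (Suc k))"])
    have M: "M \<ge> 0" using F \<psi> by (meson abs_ge_zero all_not_in_conv order_trans)
    show "(\<lambda>k. 2 * M * (1 / real (Suc k))) \<longlonglongrightarrow> 0"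
      using tendsto_mult_right_zero[OF LIMSEQ_inverse_real_of_nat] by (simp add: inverse_eq_divide)
    show "\<forall>\<^sub>F k in sequentially. norm ((\<Sum>x\<in>pverts (Gs k). h (Gs k) x) / N k - (\<Sum>\<^sub>\<infinity>f\<in>F. \<psi> f * weight f))
        \<le> 2 * M * (1 / real (Suc k))"
    proof (rule eventually_sequentiallyI)
      fix k assume k: "r \<le> k"
      have "(\<Sum>x\<in>pverts (Gs k). h (Gs k) x) = (\<Sum>x\<in>W k. h (Gs k) x) + (\<Sum>x\<in>pverts (Gs k) - W k. h (Gs k) x)"
        using sum.subset_diff[OF W finV(1), of "h (Gs k)" k] by simp
      also have "(\<Sum>x\<in>W k. h (Gs k) x) = (\<Sum>x\<in>W k. \<psi> (\<tau> k x))"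
      proof (rule sum.cong[OF refl])
        fix x assume x: "x \<in> W k"
        obtain \<pi> where "local_iso k E (\<tau> k x) (parcs (Gs k)) x \<pi>" using iso[OF x] by blast
        from local_iso_mono[OF this k] show "h (Gs k) x = \<psi> (\<tau> k x)"
          using h\<psi>[OF fin deg _ \<tau>F[OF x]] W[of k] x by blast
      qed
      finally have eq: "(\<Sum>x\<in>pverts (Gs k). h (Gs k) x) / N k
          = (\<Sum>x\<in>W k. \<psi> (\<tau> k x)) / N k + (\<Sum>x\<in>pverts (Gs k) - W k. h (Gs k) x) / N k"
        by (simp add: add_divide_distrib)
      have "\<bar>\<Sum>x\<in>pverts (Gs k) - W k. h (Gs k) x\<bar> \<le> (\<Sum>x\<in>pverts (Gs k) - W k. M)"
        by (rule order_trans[OF sum_abs sum_mono]) (use h[OF fin deg] in auto)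
      also have "\<dots> \<le> M * (1 / real (Suc k) * N k)"
        using mult_left_mono[OF rest M] by (simp add: mult.commute)
      finally have "\<bar>(\<Sum>x\<in>pverts (Gs k) - W k. h (Gs k) x) / N k\<bar> \<le> M * (1 / real (Suc k))"
        using N[of k] by (simp add: abs_divide divide_le_eq)
      then show "norm ((\<Sum>x\<in>pverts (Gs k). h (Gs k) x) / N k - (\<Sum>\<^sub>\<infinity>f\<in>F. \<psi> f * weight f))
          \<le> 2 * M * (1 / real (Suc k))"
        unfolding eq real_norm_def using stat[of \<psi> M k, OF \<psi>] by linarith
    qed
  qed
  have lim1: "(\<lambda>k. real (card (pverts (Gs k))) / N k) \<longlonglongrightarrow> volume"
    using lim[of "\<lambda>_ _. 1" 1 "\<lambda>_. 1"] by (simp add: volume_def)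
  show thesis
  proof (rule that[of Gs])
    show "finite_graph (Gs n)" "degree_bounded D (Gs n)" for n by (rule fin, rule deg)
    fix h :: "nat pair_pre_digraph \<Rightarrow> nat \<Rightarrow> real" and \<psi> M r
    assume h: "\<And>H x. finite_graph H \<Longrightarrow> degree_bounded D H \<Longrightarrow> x \<in> pverts H \<Longrightarrow> \<bar>h H x\<bar> \<le> M"
      and \<psi>: "\<And>f. f \<in> F \<Longrightarrow> \<bar>\<psi> f\<bar> \<le> M"
      and h\<psi>: "\<And>H x f \<pi>. finite_graph H \<Longrightarrow> degree_bounded D H \<Longrightarrow> x \<in> pverts H \<Longrightarrow> f \<in> F \<Longrightarrow>
        local_iso r E f (parcs H) x \<pi> \<Longrightarrow> h H x = \<psi> f"
    have "(\<lambda>k. ((\<Sum>x\<in>pverts (Gs k). h (Gs k) x) / N k) / (real (card (pverts (Gs k))) / N k))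
        \<longlonglongrightarrow> (\<Sum>\<^sub>\<infinity>f\<in>F. \<psi> f * weight f) / volume"
      using volume_pos[OF F] by (intro tendsto_divide lim[OF h \<psi> h\<psi>] lim1) simp_all
    moreover have "((\<Sum>x\<in>pverts (Gs k). h (Gs k) x) / N k) / (real (card (pverts (Gs k))) / N k)
        = (\<Sum>x\<in>pverts (Gs k). h (Gs k) x) / real (card (pverts (Gs k)))" for k
      using N[of k] by simp
    ultimately show "(\<lambda>n. (\<Sum>x\<in>pverts (Gs n). h (Gs n) x) / real (card (pverts (Gs n))))
        \<longlonglongrightarrow> (\<Sum>\<^sub>\<infinity>f\<in>F. \<psi> f * weight f) / volume"
      by (simp only:)
  qed
qed

end

section \<open>Convergence of logarithmic zeta series\<close>

lemma log_zeta_series_term_le: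
  fixes u :: complex
  assumes "\<bar>c (Suc j)\<bar> \<le> B * q ^ j" and u: "norm u \<le> \<rho>" and "q \<ge> 0" "B \<ge> 0"
  shows "norm (of_real (c (Suc j) / real (Suc j)) * u ^ Suc j) \<le> B * \<rho> * (q * \<rho>) ^ j"
proof -
  have \<rho>: "\<rho> \<ge> 0" using u norm_ge_zero order_trans by blast
  have "norm (of_real (c (Suc j) / real (Suc j)) * u ^ Suc j) = \<bar>c (Suc j)\<bar> / real (Suc j) * norm u ^ Suc j"
    by (simp only: norm_mult norm_power norm_of_real abs_divide abs_of_nat)
  also have "\<dots> \<le> \<bar>c (Suc j)\<bar> * \<rho> ^ Suc j"
  proof (rule mult_mono)
    show "\<bar>c (Suc j)\<bar> / real (Suc j) \<le> \<bar>c (Suc j)\<bar>"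
      using mult_left_mono[of 1 "real (Suc j)" "\<bar>c (Suc j)\<bar>"] by (simp add: divide_le_eq)
    show "norm u ^ Suc j \<le> \<rho> ^ Suc j" using u by (intro power_mono) auto
  qed auto
  also have "\<dots> \<le> B * q ^ j * \<rho> ^ Suc j"
    using assms(1) \<rho> by (intro mult_right_mono) auto
  also have "\<dots> = B * \<rho> * (q * \<rho>) ^ j"
    by (simp add: power_mult_distrib)
  finally show ?thesis .
qed

text \<open>
On the disc of radius \<open>\<rho>\<close> the difference of two such series is largest at \<open>\<rho>\<close> if all terms are
replaced by their absolute values. So uniform convergence reduces to one series of
real numbers, to which Tannery's theorem applies with a geometric majorant.
\<close>

lemma uniform_limit_log_zeta_series:
  fixes c :: "nat \<Rightarrow> nat \<Rightarrow> real"
  assumes bound: "\<And>n j. \<bar>c n (Suc j)\<bar> \<le> B * q ^ j"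
    and lim: "\<And>j. (\<lambda>n. c n (Suc j)) \<longlonglongrightarrow> c' (Suc j)"
    and q: "q \<ge> 0" and B: "B \<ge> 0" and \<rho>: "0 \<le> \<rho>" "q * \<rho> < 1"
  shows "uniform_limit (cball 0 \<rho>) (\<lambda>n. log_zeta_series (c n)) (log_zeta_series c') sequentially"
    and "u \<in> cball 0 \<rho> \<Longrightarrow> norm (log_zeta_series (c n) u) \<le> (\<Sum>j. B * \<rho> * (q * \<rho>) ^ j)"
    and "u \<in> cball 0 \<rho> \<Longrightarrow> norm (log_zeta_series c' u) \<le> (\<Sum>j. B * \<rho> * (q * \<rho>) ^ j)"
    and "u \<in> cball 0 \<rho> \<Longrightarrow> summable (\<lambda>j. of_real (c' (Suc j) / real (Suc j)) * u ^ Suc j)"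
proof -
  have bound': "\<bar>c' (Suc j)\<bar> \<le> B * q ^ j" for j
    using tendsto_rabs[OF lim[of j]] bound by (rule LIMSEQ_le_const2[OF _ exI, OF _ allI, OF _ impI])
  have sM: "summable (\<lambda>j. B * \<rho> * (q * \<rho>) ^ j)"
    using q \<rho> by (intro summable_mult summable_geometric) simp
  have t: "norm (of_real (c n (Suc j) / real (Suc j)) * u ^ Suc j) \<le> B * \<rho> * (q * \<rho>) ^ j"
    "norm (of_real (c' (Suc j) / real (Suc j)) * u ^ Suc j) \<le> B * \<rho> * (q * \<rho>) ^ j"
    if "norm u \<le> \<rho>" for u :: complex and n j
    using that q B by (intro log_zeta_series_term_le bound bound'; simp)+
  have s: "summable (\<lambda>j. norm (of_real (c n (Suc j) / real (Suc j)) * u ^ Suc j))"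
    "summable (\<lambda>j. norm (of_real (c' (Suc j) / real (Suc j)) * u ^ Suc j))"
    if "norm u \<le> \<rho>" for u :: complex and n
    using t[OF that] by (auto intro!: summable_comparison_test'[OF sM] simp del: power_Suc of_nat_Suc)
  show "summable (\<lambda>j. of_real (c' (Suc j) / real (Suc j)) * u ^ Suc j)" if "u \<in> cball 0 \<rho>"
    for u :: complex
  proof -
    have u: "norm u \<le> \<rho>" using that by simp
    show ?thesis by (rule summable_norm_cancel[OF s(2)[OF u]])
  qed
  show "norm (log_zeta_series (c n) u) \<le> (\<Sum>j. B * \<rho> * (q * \<rho>) ^ j)" if "u \<in> cball 0 \<rho>" for n u
  proof -
    have u: "norm u \<le> \<rho>" using that by simp
    show ?thesis
      unfolding log_zeta_series_def
      by (rule order_trans[OF summable_norm[OF s(1)[OF u]] suminf_le[OF t(1)[OF u] s(1)[OF u] sM]])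
  qed
  show "norm (log_zeta_series c' u) \<le> (\<Sum>j. B * \<rho> * (q * \<rho>) ^ j)" if "u \<in> cball 0 \<rho>" for u
  proof -
    have u: "norm u \<le> \<rho>" using that by simp
    show ?thesis
      unfolding log_zeta_series_def
      by (rule order_trans[OF summable_norm[OF s(2)[OF u]] suminf_le[OF t(2)[OF u] s(2)[OF u] sM]])
  qed
  define d where "d = (\<lambda>n j. (c n (Suc j) - c' (Suc j)) / real (Suc j) * \<rho> ^ Suc j)"
  have sd: "summable (\<lambda>j. 2 * (B * \<rho> * (q * \<rho>) ^ j))" using sM by (rule summable_mult)
  have norm_real: "norm (of_real a * of_real \<rho> ^ m :: complex) = norm (a * \<rho> ^ m)" for a m
    by (metis norm_of_real of_real_mult of_real_power real_norm_def)
  have d_le: "norm (d n j) \<le> 2 * (B * \<rho> * (q * \<rho>) ^ j)" for n j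
  proof -
    have "d n j = c n (Suc j) / real (Suc j) * \<rho> ^ Suc j - c' (Suc j) / real (Suc j) * \<rho> ^ Suc j"
      unfolding d_def diff_divide_distrib left_diff_distrib ..
    then have "norm (d n j) \<le> norm (c n (Suc j) / real (Suc j) * \<rho> ^ Suc j)
        + norm (c' (Suc j) / real (Suc j) * \<rho> ^ Suc j)"
      by (simp only: norm_triangle_ineq4)
    also have "\<dots> \<le> B * \<rho> * (q * \<rho>) ^ j + B * \<rho> * (q * \<rho>) ^ j"
      using t(1)[where u = "of_real \<rho>" and n = n and j = j] t(2)[where u = "of_real \<rho>" and j = j] \<rho>(1)
      unfolding norm_real by (intro add_mono) (simp_all del: power_Suc of_nat_Suc)
    finally show ?thesis by simp
  qed
  have d0: "(\<lambda>n. d n j) \<longlonglongrightarrow> 0" for j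
  proof -
    have "(\<lambda>n. (c n (Suc j) - c' (Suc j)) / real (Suc j) * \<rho> ^ Suc j) \<longlonglongrightarrow> 0 / real (Suc j) * \<rho> ^ Suc j"
      using LIM_zero[OF lim[of j]] by (intro tendsto_mult tendsto_divide tendsto_const) auto
    then show ?thesis by (simp add: d_def)
  qed
  have "(\<lambda>n. \<Sum>j. norm (d n j)) \<longlonglongrightarrow> (\<Sum>j::nat. (0::real))"
    using tannerys_theorem[where a = "\<lambda>j n. norm (d n j)" and b = "\<lambda>_. 0"
        and M = "\<lambda>j. 2 * (B * \<rho> * (q * \<rho>) ^ j)" and F = sequentially]
      tendsto_norm_zero[OF d0] sd d_le by (simp add: always_eventually case_prod_beta)
  then have dlim: "(\<lambda>n. \<Sum>j. norm (d n j)) \<longlonglongrightarrow> 0" by simp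
  show "uniform_limit (cball 0 \<rho>) (\<lambda>n. log_zeta_series (c n)) (log_zeta_series c') sequentially"
  proof (rule uniform_limitI)
    fix e :: real assume "e > 0"
    with dlim have "\<forall>\<^sub>F n in sequentially. (\<Sum>j. norm (d n j)) < e"
      by (rule order_tendstoD)
    then show "\<forall>\<^sub>F n in sequentially. \<forall>u\<in>cball 0 \<rho>. dist (log_zeta_series (c n) u) (log_zeta_series c' u) < e"
    proof (rule eventually_mono, intro ballI)
      fix n and u :: complex
      assume n: "(\<Sum>j. norm (d n j)) < e" and "u \<in> cball 0 \<rho>"
      then have u: "norm u \<le> \<rho>" by simp
      have sdn: "summable (\<lambda>j. norm (d n j))"
        using d_le by (auto intro!: summable_comparison_test'[OF sd])
      have le: "norm (of_real (c n (Suc j) / real (Suc j)) * u ^ Suc j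
          - of_real (c' (Suc j) / real (Suc j)) * u ^ Suc j) \<le> norm (d n j)" for j
      proof -
        have "of_real (c n (Suc j) / real (Suc j)) * u ^ Suc j
          - of_real (c' (Suc j) / real (Suc j)) * u ^ Suc j
          = of_real ((c n (Suc j) - c' (Suc j)) / real (Suc j)) * u ^ Suc j"
          by (simp add: diff_divide_distrib left_diff_distrib)
        also have "norm \<dots> = \<bar>(c n (Suc j) - c' (Suc j)) / real (Suc j)\<bar> * norm u ^ Suc j"
          by (simp only: norm_mult norm_power norm_of_real)
        also have "\<dots> \<le> \<bar>(c n (Suc j) - c' (Suc j)) / real (Suc j)\<bar> * \<rho> ^ Suc j"
          using u by (intro mult_left_mono power_mono) auto
        also have "\<dots> = norm (d n j)"
          using \<rho>(1) by (simp add: d_def abs_mult)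
        finally show ?thesis .
      qed
      have "dist (log_zeta_series (c n) u) (log_zeta_series c' u)
          = norm (\<Sum>j. of_real (c n (Suc j) / real (Suc j)) * u ^ Suc j
              - of_real (c' (Suc j) / real (Suc j)) * u ^ Suc j)"
        unfolding dist_norm log_zeta_series_def
        by (subst suminf_diff[OF summable_norm_cancel[OF s(1)[OF u]] summable_norm_cancel[OF s(2)[OF u]]])
          (rule refl)
      also have "\<dots> \<le> (\<Sum>j. norm (d n j))"
        using le sdn by (rule norm_suminf_le)
      finally show "dist (log_zeta_series (c n) u) (log_zeta_series c' u) < e" using n by simp
    qed
  qed
qed

section \<open>Isomorphism classes of rooted balls\<close>

lemma graph_isomorphism_inv:
  assumes "graph_isomorphism f A B"
  shows "graph_isomorphism (inv_into (pverts A) f) B A"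
proof -
  have f: "bij_betw f (pverts A) (pverts B)" using assms by (simp add: graph_isomorphism_def)
  have *: "inv_into (pverts A) f x \<in> pverts A" "f (inv_into (pverts A) f x) = x" if "x \<in> pverts B" for x
    using f that by (auto simp: bij_betw_def inv_into_into f_inv_into_f)
  show ?thesis
    using assms bij_betw_inv_into[OF f] * by (auto simp: graph_isomorphism_def)
qed

lemma graph_isomorphism_compose:
  assumes "graph_isomorphism f A B" "graph_isomorphism g B C"
  shows "graph_isomorphism (g \<circ> f) A C"
proof -
  have "bij_betw (g \<circ> f) (pverts A) (pverts C)"
    using assms bij_betw_trans by (auto simp: graph_isomorphism_def)
  moreover have "f x \<in> pverts B" if "x \<in> pverts A" for x
    using assms(1) that by (auto simp: graph_isomorphism_def bij_betw_def)
  ultimately show ?thesis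
    using assms by (auto simp: graph_isomorphism_def)
qed

text \<open>
Isomorphisms carry walks to walks, hence preserve distances and radii. This makes the radius of an
isomorphism class well defined.
\<close>

lemma graph_isomorphism_relpow:
  assumes "graph_isomorphism f A B" "parcs A \<subseteq> pverts A \<times> pverts A"
    and "x \<in> pverts A" "(x, y) \<in> parcs A ^^ k"
  shows "(f x, f y) \<in> parcs B ^^ k"
  using assms(4)
proof (induction k arbitrary: y)
  case (Suc k)
  then obtain z where z: "(x, z) \<in> parcs A ^^ k" "(z, y) \<in> parcs A" by auto
  then have "(f z, f y) \<in> parcs B"
    using assms(1,2) by (auto simp: graph_isomorphism_def)
  then show ?case using Suc.IH[OF z(1)] by auto
qed simp

lemma graph_isomorphism_graph_dist:
  assumes f: "graph_isomorphism f A B"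
    and A: "pair_bidirected_digraph A" and B: "pair_bidirected_digraph B"
    and xy: "x \<in> pverts A" "y \<in> pverts A"
  shows "graph_dist B (f x) (f y) = graph_dist A x y"
proof -
  have inj: "inj_on f (pverts A)" and fx: "f x \<in> pverts B"
    using f xy by (auto simp: graph_isomorphism_def bij_betw_def)
  have E: "parcs A \<subseteq> pverts A \<times> pverts A" "parcs B \<subseteq> pverts B \<times> pverts B"
    using A B by (auto simp: pair_bidirected_digraph_iff)
  have "(f x, f y) \<in> parcs B ^^ k \<longleftrightarrow> (x, y) \<in> parcs A ^^ k" for k
    using graph_isomorphism_relpow[OF f E(1) xy(1), of y k]
      graph_isomorphism_relpow[OF graph_isomorphism_inv[OF f] E(2) fx, of "f y" k]
      inv_into_f_f[OF inj xy(1)] inv_into_f_f[OF inj xy(2)] by auto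
  then show ?thesis
    by (simp add: graph_dist_eq[OF A xy(1)] graph_dist_eq[OF B fx])
qed

lemma rooted_graphsD:
  assumes "(A, a) \<in> rooted_graphs D"
  shows "pair_bidirected_digraph A" "finite (pverts A)" "a \<in> pverts A"
    "Digraph_Component.connected (with_proj A)"
  using assms by (auto simp: rooted_graphs_def finite_graph_def)

lemma radius_nat:
  assumes A: "(A, a) \<in> rooted_graphs D"
  shows "\<exists>r. radius (A, a) = ereal (real r)"
proof -
  note A' = rooted_graphsD[OF A]
  have "radius (A, a) \<in> graph_dist A a ` pverts A"
    unfolding radius_def using A' by (auto intro!: Max_in)
  then obtain y where y: "y \<in> pverts A" "radius (A, a) = graph_dist A a y" by auto
  have "(a, y) \<in> (parcs A)\<^sup>*" using connected_iff_rtrancl[OF A'(1)] A' y by auto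
  then obtain k where "(a, y) \<in> parcs A ^^ k" unfolding rtrancl_power by blast
  then show ?thesis using graph_dist_eq_Least[OF A'(1,3)] y by auto
qed

lemma rooted_iso_radius:
  assumes "((A, a), (B, b)) \<in> rooted_iso D"
  shows "radius (B, b) = radius (A, a)"
proof -
  obtain f where A: "(A, a) \<in> rooted_graphs D" and B: "(B, b) \<in> rooted_graphs D"
    and f: "graph_isomorphism f A B" "f a = b"
    using assms by (auto simp: rooted_iso_def)
  note A' = rooted_graphsD[OF A] and B' = rooted_graphsD[OF B]
  have "pverts B = f ` pverts A" using f by (auto simp: graph_isomorphism_def bij_betw_def)
  then have "graph_dist B b ` pverts B = graph_dist A a ` pverts A"
    using graph_isomorphism_graph_dist[OF f(1) A'(1) B'(1) A'(3)] f(2)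
    by (simp add: image_image)
  then show ?thesis by (simp add: radius_def)
qed

lemma rooted_classesE:
  assumes "\<alpha> \<in> rooted_classes D"
  obtains A a where "(A, a) \<in> rooted_graphs D" "\<alpha> = rooted_iso D `` {(A, a)}" "(A, a) \<in> \<alpha>"
proof -
  obtain A a where A: "(A, a) \<in> rooted_graphs D" "\<alpha> = rooted_iso D `` {(A, a)}"
    using assms unfolding rooted_classes_def by (auto elim!: quotientE)
  have "graph_isomorphism id A A" by (simp add: graph_isomorphism_def)
  then have "((A, a), (A, a)) \<in> rooted_iso D"
    using A(1) by (auto simp: rooted_iso_def intro!: exI[of _ id])
  then show thesis using that A by auto
qed

text \<open>
The definite description in \<open>class_radius\<close> is meaningful because the class is nonempty and
its members have the same radius. That the radius is a natural number, not infinite, makes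
membership of a ball in the class a local property.
\<close>

lemma class_radius_nat:
  assumes "\<alpha> \<in> rooted_classes D"
  obtains r where "class_radius \<alpha> = ereal (real r)"
proof -
  obtain A a where A: "(A, a) \<in> rooted_graphs D" "\<alpha> = rooted_iso D `` {(A, a)}" "(A, a) \<in> \<alpha>"
    using rooted_classesE[OF assms] .
  have "radius B = radius (A, a)" if "B \<in> \<alpha>" for B
    using that A(2) rooted_iso_radius[of A a "fst B" "snd B" D] by auto
  then have "class_radius \<alpha> = radius (A, a)"
    unfolding class_radius_def
  proof (intro the_equality ballI)
    fix r assume "\<forall>B\<in>\<alpha>. radius B = r"
    from bspec[OF this A(3)] show "r = radius (A, a)" by (rule sym)
  qed
  moreover obtain r where "radius (A, a) = ereal (real r)" using radius_nat[OF A(1)] by blast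
  ultimately show thesis using that[of r] by simp
qed

lemma rooted_class_closed:
  assumes \<alpha>: "\<alpha> \<in> rooted_classes D" and B: "(B, b) \<in> \<alpha>" and C: "(C, c) \<in> rooted_graphs D"
    and f: "graph_isomorphism f B C" "f b = c"
  shows "(C, c) \<in> \<alpha>"
proof -
  obtain A a where A: "(A, a) \<in> rooted_graphs D" "\<alpha> = rooted_iso D `` {(A, a)}" "(A, a) \<in> \<alpha>"
    using rooted_classesE[OF \<alpha>] .
  obtain g where g: "graph_isomorphism g A B" "g a = b"
    using B A(2) by (auto simp: rooted_iso_def)
  have "graph_isomorphism (f \<circ> g) A C" "(f \<circ> g) a = c"
    using graph_isomorphism_compose[OF g(1) f(1)] g(2) f(2) by auto
  then have "((A, a), (C, c)) \<in> rooted_iso D"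
    using A(1) C by (auto simp: rooted_iso_def)
  then show ?thesis using A(2) by simp
qed

text \<open>
Members of a class are graphs over the natural numbers; this is the corresponding
property for rooted graphs over any vertex type.
\<close>

definition in_rooted_class :: "nat rooted_graph set \<Rightarrow> 'v rooted_graph \<Rightarrow> bool" where
  "in_rooted_class \<alpha> A \<longleftrightarrow>
     (\<exists>(B, b)\<in>\<alpha>. \<exists>g. graph_isomorphism g (fst A) B \<and> g (snd A) = b)"

text \<open>
The set \<open>\<alpha>\<close> is closed only under isomorphisms to members of \<open>rooted_graphs D\<close>, so it matters that balls of
\<open>H\<close> are finite, connected and of bounded degree.
\<close>

lemma local_iso_in_rooted_class:
  assumes \<alpha>: "\<alpha> \<in> rooted_classes D" and H: "finite_graph H" "degree_bounded D H"
    and G: "pair_bidirected_digraph G" and x: "x \<in> pverts H" and f: "f \<in> pverts G"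
    and l: "local_iso r (parcs G) f (parcs H) x \<pi>"
  shows "rooted_ball H (ereal (real r)) x \<in> \<alpha> \<longleftrightarrow>
    in_rooted_class \<alpha> (rooted_ball G (ereal (real r)) f)"
proof -
  have H': "pair_bidirected_digraph H" using H by (simp add: finite_graph_def)
  define BG where "BG = induced_graph G (rel_ball (parcs G) r f)"
  define BH where "BH = induced_graph H (rel_ball (parcs H) r x)"
  have bG: "rooted_ball G (ereal (real r)) f = (BG, f)" and bH: "rooted_ball H (ereal (real r)) x = (BH, x)"
    by (simp_all add: BG_def BH_def rooted_ball_eq G H' x f)
  have \<pi>: "graph_isomorphism \<pi> BG BH" "\<pi> f = x"
    using local_iso_graph_isomorphism[OF l order_refl] local_isoD(1)[OF l]
    by (simp_all add: BG_def BH_def)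
  have fB: "f \<in> pverts BG" by (simp add: BG_def induced_graph_def rel_ball_center)
  have r: "(BH, x) \<in> rooted_graphs D"
    using rooted_ball_in_rooted_graphs[OF H x, of r] by (simp add: bH)
  show ?thesis
    unfolding bG bH
  proof
    assume "(BH, x) \<in> \<alpha>"
    then show "in_rooted_class \<alpha> (BG, f)" using \<pi> by (auto simp: in_rooted_class_def)
  next
    assume "in_rooted_class \<alpha> (BG, f)"
    then obtain B g where B: "(B, g f) \<in> \<alpha>" and g: "graph_isomorphism g BG B"
      by (auto simp: in_rooted_class_def)
    have inj: "inj_on g (pverts BG)" using g by (auto simp: graph_isomorphism_def bij_betw_def)
    show "(BH, x) \<in> \<alpha>"
    proof (rule rooted_class_closed[OF \<alpha> B r])
      show "graph_isomorphism (\<pi> \<circ> inv_into (pverts BG) g) B BH"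
        by (rule graph_isomorphism_compose[OF graph_isomorphism_inv[OF g] \<pi>(1)])
      show "(\<pi> \<circ> inv_into (pverts BG) g) (g f) = x"
        using inv_into_f_f[OF inj fB] \<pi>(2) by simp
    qed
  qed
qed

section \<open>Weak convergence and convergence of zeta functions\<close>

lemma automorphism_group_simps:
  "carrier (subgroup_of_aut G \<Gamma>) = \<Gamma>"
  "\<one>\<^bsub>subgroup_of_aut G \<Gamma>\<^esub> = (\<lambda>x\<in>pverts G. x)"
  "mult (subgroup_of_aut G \<Gamma>) = (\<lambda>g\<in>Bij (pverts G). \<lambda>f\<in>Bij (pverts G). compose (pverts G) g f)"
  by (simp_all add: automorphism_group_def BijGroup_def)

text \<open>
Automorphisms are extensional functions, and evaluation at vertices turns their restricted composition into
an action. A fundamental domain meets the orbit of \<open>v\<close> in one point \<open>f\<close>, which has the form \<open>g v\<close>; the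
inverse of \<open>g\<close> moves \<open>f\<close> to \<open>v\<close>.
\<close>

lemma periodic_graph_periodic_action:
  assumes G: "periodic_graph G \<Gamma>" and deg: "degree_bounded D G"
    and sofic: "sofic_group (subgroup_of_aut G \<Gamma>)" and F: "fundamental_domain G \<Gamma> F"
  shows "periodic_action (subgroup_of_aut G \<Gamma>) (\<lambda>\<gamma>. \<gamma>) (pverts G) (parcs G) F D"
proof -
  have bid: "pair_bidirected_digraph G" using G by (simp add: periodic_graph_def)
  then have E: "parcs G \<subseteq> pverts G \<times> pverts G" "sym (parcs G)" "\<And>x. (x, x) \<notin> parcs G"
    by (auto simp: pair_bidirected_digraph_iff)
  have "\<Gamma> \<subseteq> carrier (automorphism_group G)"
    using G by (simp add: periodic_graph_def subgroup.subset)
  then have aut: "\<gamma> \<in> Bij (pverts G)" "graph_isomorphism \<gamma> G G" if "\<gamma> \<in> \<Gamma>" for \<gamma>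
    using that by (auto simp: automorphism_group_def)
  have closed: "\<gamma> x \<in> pverts G" if "\<gamma> \<in> \<Gamma>" "x \<in> pverts G" for \<gamma> x
    using Bij_imp_funcset[OF aut(1)[OF that(1)]] that(2) by auto
  have grp: "group (subgroup_of_aut G \<Gamma>)" using sofic by (simp add: sofic_group_def)
  then interpret group "subgroup_of_aut G \<Gamma>" .
  have mult: "(\<gamma> \<otimes>\<^bsub>subgroup_of_aut G \<Gamma>\<^esub> \<delta>) v = \<gamma> (\<delta> v)"
    if "\<gamma> \<in> \<Gamma>" "\<delta> \<in> \<Gamma>" "v \<in> pverts G" for \<gamma> \<delta> v
    using aut(1) that by (simp add: automorphism_group_simps compose_eq)
  have one: "\<one>\<^bsub>subgroup_of_aut G \<Gamma>\<^esub> v = v" if "v \<in> pverts G" for v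
    using that by (simp add: automorphism_group_simps)
  have FV: "F \<subseteq> pverts G" using F by (simp add: fundamental_domain_def)
  show ?thesis
  proof (intro periodic_action.intro periodic_action_axioms.intro)
    show "group (subgroup_of_aut G \<Gamma>)" by (rule grp)
    fix v assume v: "v \<in> pverts G"
    define X where "X = Group_Action.orbit (subgroup_of_aut G \<Gamma>) (\<lambda>\<gamma>. \<gamma>) v"
    have "X \<in> orbits (subgroup_of_aut G \<Gamma>) (pverts G) (\<lambda>\<gamma>. \<gamma>)"
      using v by (auto simp: X_def orbits_def)
    then have ex1: "\<exists>!f. f \<in> F \<and> f \<in> X"
      using F by (simp add: fundamental_domain_def)
    have "f \<in> X \<longleftrightarrow> (\<exists>g\<in>carrier (subgroup_of_aut G \<Gamma>). g f = v)" if f: "f \<in> F" for f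
    proof
      assume "f \<in> X"
      then obtain g where g: "g \<in> \<Gamma>" "f = g v" by (auto simp: X_def Group_Action.orbit_def)
      then have i: "inv\<^bsub>subgroup_of_aut G \<Gamma>\<^esub> g \<in> \<Gamma>" using inv_closed[of g] by simp
      have "(inv\<^bsub>subgroup_of_aut G \<Gamma>\<^esub> g) f = v"
        using mult[OF i g(1) v] l_inv[of g] one[OF v] g by simp
      then show "\<exists>g\<in>carrier (subgroup_of_aut G \<Gamma>). g f = v" using i by auto
    next
      assume "\<exists>g\<in>carrier (subgroup_of_aut G \<Gamma>). g f = v"
      then obtain g where g: "g \<in> \<Gamma>" "g f = v" by auto
      then have i: "inv\<^bsub>subgroup_of_aut G \<Gamma>\<^esub> g \<in> \<Gamma>" using inv_closed[of g] by simp
      have "(inv\<^bsub>subgroup_of_aut G \<Gamma>\<^esub> g) v = f"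
        using mult[OF i g(1), of f] l_inv[of g] one[of f] g f FV by auto
      then show "f \<in> X" using i by (auto simp: X_def Group_Action.orbit_def)
    qed
    then show "\<exists>!f. f \<in> F \<and> (\<exists>g\<in>carrier (subgroup_of_aut G \<Gamma>). g f = v)"
      using ex1 by (metis (no_types, lifting))
    show "finite (parcs G `` {v})" "card (parcs G `` {v}) \<le> D"
      using deg v by (auto simp: degree_bounded_iff)
    show "finite (vertex_stabilizer G \<Gamma> v)" using G v by (simp add: periodic_graph_def)
    show "\<one>\<^bsub>subgroup_of_aut G \<Gamma>\<^esub> v = v" by (rule one[OF v])
  next
    fix g v w assume g: "g \<in> carrier (subgroup_of_aut G \<Gamma>)" and vw: "(v, w) \<in> parcs G"
    then show "(g v, g w) \<in> parcs G"
      using aut(2)[of g] E(1) by (auto simp: graph_isomorphism_def)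
  qed (use E FV F closed mult in \<open>auto simp: fundamental_domain_def\<close>)
qed

theorem corollary6p4:
  fixes G :: "'v pair_pre_digraph" and \<Gamma> :: "('v \<Rightarrow> 'v) set" and F :: "'v set" and D :: nat
  assumes "periodic_graph G \<Gamma>"
    and "degree_bounded D G"
    and "sofic_group (subgroup_of_aut G \<Gamma>)"
    and "fundamental_domain G \<Gamma> F"
  shows "\<exists>Gs :: nat \<Rightarrow> nat pair_pre_digraph. weakly_convergent D Gs \<and>
    (\<forall>K. compact K \<and> K \<subseteq> ball (0::complex) (1 / (real D - 1)) \<longrightarrow>
      uniform_limit K (\<lambda>n u. Z_norm_pow (covolume G \<Gamma> F) (Gs n) u)
        (\<lambda>u. Z_periodic G \<Gamma> F u) sequentially)"
proof -
  interpret periodic_action "subgroup_of_aut G \<Gamma>" "\<lambda>\<gamma>. \<gamma>" "pverts G" "parcs G" F D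
    by (rule periodic_graph_periodic_action[OF assms])
  have bid: "pair_bidirected_digraph G" using assms(1) by (simp add: periodic_graph_def)
  have vol: "covolume G \<Gamma> F = volume"
    by (simp add: covolume_def volume_def weight_def)
  have "pverts G \<noteq> {}" using assms(1) by (auto simp: periodic_graph_def)
  then have F: "F \<noteq> {}" using rep_in_domain by auto
  then have vpos: "volume > 0" by (rule volume_pos)
  show ?thesis
  proof (rule convergent_models_exist[OF assms(3) F])
    fix Gs :: "nat \<Rightarrow> nat pair_pre_digraph"
    assume Gs: "\<And>n. finite_graph (Gs n)" "\<And>n. degree_bounded D (Gs n)"
      and lim: "\<And>h \<psi> M r.
      (\<And>H x. finite_graph H \<Longrightarrow> degree_bounded D H \<Longrightarrow> x \<in> pverts H \<Longrightarrow> \<bar>h H x\<bar> \<le> M) \<Longrightarrow>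
      (\<And>f. f \<in> F \<Longrightarrow> \<bar>\<psi> f\<bar> \<le> M) \<Longrightarrow>
      (\<And>H x f \<pi>. finite_graph H \<Longrightarrow> degree_bounded D H \<Longrightarrow> x \<in> pverts H \<Longrightarrow> f \<in> F \<Longrightarrow>
        local_iso r (parcs G) f (parcs H) x \<pi> \<Longrightarrow> h H x = \<psi> f) \<Longrightarrow>
      (\<lambda>n. (\<Sum>x\<in>pverts (Gs n). h (Gs n) x) / real (card (pverts (Gs n))))
        \<longlonglongrightarrow> (\<Sum>\<^sub>\<infinity>f\<in>F. \<psi> f * weight f) / volume"
    have "weakly_convergent D Gs"
      unfolding weakly_convergent_def
    proof (intro conjI allI ballI Gs)
      fix \<alpha> assume \<alpha>: "\<alpha> \<in> rooted_classes D"
      obtain r where r: "class_radius \<alpha> = ereal (real r)" using class_radius_nat[OF \<alpha>] .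
      define h :: "nat pair_pre_digraph \<Rightarrow> nat \<Rightarrow> real"
        where "h = (\<lambda>H x. of_bool (rooted_ball H (ereal (real r)) x \<in> \<alpha>))"
      define \<psi> :: "'v \<Rightarrow> real"
        where "\<psi> = (\<lambda>f. of_bool (in_rooted_class \<alpha> (rooted_ball G (ereal (real r)) f)))"
      have "(\<lambda>n. (\<Sum>x\<in>pverts (Gs n). h (Gs n) x) / real (card (pverts (Gs n))))
        \<longlonglongrightarrow> (\<Sum>\<^sub>\<infinity>f\<in>F. \<psi> f * weight f) / volume"
      proof (rule lim[of h 1 \<psi> r])
        show "h H x = \<psi> f"
          if "finite_graph H" "degree_bounded D H" "x \<in> pverts H" "f \<in> F"
            "local_iso r (parcs G) f (parcs H) x \<pi>" for H x f \<pi>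
          using local_iso_in_rooted_class[OF \<alpha> that(1,2) bid that(3) _ that(5)] that(4) domain_in_verts
          by (auto simp: h_def \<psi>_def)
      qed (auto simp: h_def \<psi>_def)
      moreover have "(\<Sum>x\<in>pverts (Gs n). h (Gs n) x) / real (card (pverts (Gs n))) = frequency (Gs n) \<alpha>" for n
        using Gs(1)[of n] by (simp add: h_def frequency_def r finite_graph_def Int_def)
      ultimately show "convergent (\<lambda>n. frequency (Gs n) \<alpha>)"
        by (auto simp: convergent_def)
    qed
    moreover have "uniform_limit K (\<lambda>n u. Z_norm_pow (covolume G \<Gamma> F) (Gs n) u)
        (\<lambda>u. Z_periodic G \<Gamma> F u) sequentially"
      if K: "compact K" "K \<subseteq> ball (0::complex) (1 / (real D - 1))" for K
    proof (cases "D \<le> 1 \<or> K = {}")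
      case True
      \<comment> \<open>For \<open>D \<le> 1\<close> the disc is empty: its radius is \<open>-1\<close> or, as \<open>1 / 0 = 0\<close>, zero.\<close>
      have "K = {}"
      proof (cases "K = {}")
        case False
        then have "D = 0 \<or> D = 1" using True by auto
        then have "1 / (real D - 1) \<le> 0" by auto
        then show ?thesis using K(2) by (simp add: ball_empty)
      qed
      then show ?thesis by (simp add: uniform_limit_iff)
    next
      case False
      then have D: "D \<ge> 2" and K_ne: "K \<noteq> {}" by auto
      define q where "q = real (D - 1)"
      have q: "q > 0" "q = real D - 1" using D by (auto simp: q_def of_nat_diff)
      \<comment> \<open>By compactness \<open>K\<close> lies in a closed disc of a radius \<open>\<rho>\<close> strictly below \<open>1 / q\<close>.\<close>
      obtain z where z: "z \<in> K" "\<And>u. u \<in> K \<Longrightarrow> norm u \<le> norm z"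
        using continuous_attains_sup[OF K(1) K_ne, of norm] by (auto intro: continuous_intros)
      define \<rho> where "\<rho> = norm z"
      have K\<rho>: "K \<subseteq> cball 0 \<rho>" using z by (auto simp: \<rho>_def)
      have "\<rho> < 1 / q" using z(1) K(2) q by (auto simp: \<rho>_def)
      then have \<rho>: "0 \<le> \<rho>" "q * \<rho> < 1"
        using q(1) by (simp_all add: less_divide_eq mult.commute) (simp add: \<rho>_def)
      define c where "c = (\<lambda>n j. (\<Sum>x\<in>pverts (Gs n). real (num_reduced_closed_paths (Gs n) j x)) / real (card (pverts (Gs n))))"
      define c' where "c' = (\<lambda>j. \<Sum>\<^sub>\<infinity>x\<in>F. real (num_reduced_closed_paths G j x) / real (card (vertex_stabilizer G \<Gamma> x)))"
      have clim: "(\<lambda>n. c n (Suc j)) \<longlonglongrightarrow> c' (Suc j) / volume" for j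
      proof -
        have "(\<lambda>n. c n (Suc j)) \<longlonglongrightarrow>
          (\<Sum>\<^sub>\<infinity>f\<in>F. real (num_reduced_closed_paths G (Suc j) f) * weight f) / volume"
          unfolding c_def
        proof (rule lim[of "\<lambda>H x. real (num_reduced_closed_paths H (Suc j) x)" "real D * q ^ j"
              "\<lambda>f. real (num_reduced_closed_paths G (Suc j) f)" "Suc j"])
          show "\<bar>real (num_reduced_closed_paths H (Suc j) x)\<bar> \<le> real D * q ^ j"
            if "finite_graph H" "degree_bounded D H" "x \<in> pverts H" for H :: "nat pair_pre_digraph" and x
            using num_reduced_closed_paths_le[of H] that by (simp add: finite_graph_def q_def)
          show "\<bar>real (num_reduced_closed_paths G (Suc j) f)\<bar> \<le> real D * q ^ j" if "f \<in> F" for f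
            using num_reduced_closed_paths_le[OF bid assms(2)] that domain_in_verts by (auto simp: q_def)
          show "real (num_reduced_closed_paths H (Suc j) x) = real (num_reduced_closed_paths G (Suc j) f)"
            if "x \<in> pverts H" "f \<in> F" "local_iso (Suc j) (parcs G) f (parcs H) x \<pi>"
            for H :: "nat pair_pre_digraph" and x f \<pi>
            using local_iso_num_reduced_closed_paths[OF that(3), of "Suc j"] that domain_in_verts by auto
        qed
        then show ?thesis by (simp add: c'_def weight_def)
      qed
      have cbound: "\<bar>c n (Suc j)\<bar> \<le> real D * q ^ j" for n j
      proof -
        have "(\<Sum>x\<in>pverts (Gs n). real (num_reduced_closed_paths (Gs n) (Suc j) x))
            \<le> (\<Sum>x\<in>pverts (Gs n). real D * q ^ j)"
          using num_reduced_closed_paths_le[of "Gs n"] Gs[of n]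
          by (intro sum_mono) (auto simp: finite_graph_def q_def)
        moreover have "card (pverts (Gs n)) > 0"
          using Gs(1)[of n] by (auto simp: finite_graph_def card_gt_0_iff)
        ultimately show ?thesis
          unfolding c_def by (simp add: divide_le_eq mult.commute sum_nonneg)
      qed
      note L = uniform_limit_log_zeta_series[of c "real D" q "\<lambda>j. c' j / volume" \<rho>,
          OF cbound clim less_imp_le[OF q(1)] of_nat_0_le_iff \<rho>]
      define B where "B = (\<Sum>j. real D * \<rho> * (q * \<rho>) ^ j)"
      define l where "l = (\<lambda>n u. of_real volume * log_zeta_series (c n) u)"
      define l' where "l' = (\<lambda>u. of_real volume * log_zeta_series (\<lambda>j. c' j / volume) u)"
      have "uniform_limit K (\<lambda>n. log_zeta_series (c n)) (log_zeta_series (\<lambda>j. c' j / volume)) sequentially"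
        by (rule uniform_limit_on_subset[OF L(1) K\<rho>])
      then have ul: "uniform_limit K l l' sequentially"
        unfolding l_def l'_def by (rule bounded_linear.uniform_limit[OF bounded_linear_mult_right])
      have l_in: "l n u \<in> cball 0 (volume * B)" "l' u \<in> cball 0 (volume * B)" if "u \<in> K" for n u
        using L(2)[of u n] L(3)[of u] subsetD[OF K\<rho> that] vpos
        by (simp_all add: l_def l'_def B_def norm_mult)
      have "uniformly_continuous_on (cball 0 (volume * B)) (exp :: complex \<Rightarrow> complex)"
        by (intro compact_uniformly_continuous continuous_intros compact_cball)
      then have "uniform_limit K (\<lambda>n u. exp (l n u)) (exp \<circ> l') sequentially"
        using l_in by (intro uniform_limit_compose[OF ul] always_eventually allI image_subsetI) auto
      moreover have Z: "exp (l n u) = Z_norm_pow (covolume G \<Gamma> F) (Gs n) u" for n u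
        by (simp add: l_def Z_norm_pow_def vol c_def)
      moreover have Z': "(exp \<circ> l') u = Z_periodic G \<Gamma> F u" if "u \<in> K" for u
      proof -
        have "l' u = (\<Sum>j. of_real volume * (of_real (c' (Suc j) / volume / real (Suc j)) * u ^ Suc j))"
          unfolding l'_def log_zeta_series_def
          by (rule suminf_mult[OF L(4)[OF subsetD[OF K\<rho> that]], symmetric])
        also have "\<dots> = log_zeta_series c' u"
          unfolding log_zeta_series_def
        proof (intro suminf_cong)
          fix j
          have "volume * (c' (Suc j) / volume / real (Suc j)) = c' (Suc j) / real (Suc j)"
            using vpos by simp
          then show "of_real volume * (of_real (c' (Suc j) / volume / real (Suc j)) * u ^ Suc j)
              = of_real (c' (Suc j) / real (Suc j)) * u ^ Suc j"
            by (metis mult.assoc of_real_mult)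
        qed
        finally show ?thesis by (simp add: Z_periodic_def c'_def)
      qed
      ultimately show ?thesis
        using uniform_limit_cong'[of K "\<lambda>n u. exp (l n u)" "\<lambda>n u. Z_norm_pow (covolume G \<Gamma> F) (Gs n) u"
            "exp \<circ> l'" "Z_periodic G \<Gamma> F" sequentially] by simp
    qed
    ultimately show ?thesis by blast
  qed
qed

end
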